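(* Let $\alpha,\beta\ge0$ with $\alpha+\beta>0$ and $\gamma=\sqrt{2(\alpha^2+\beta^2)}$. (a) For every $(f_1,f_2)\in\mathcal C$, $$\lim_{n\to\infty}P_{n\alpha,n\beta}(f_1,f_2)=P^{\mathrm{skew}}_{\alpha,\beta}(f_1,f_2),$$ where $$P^{\mathrm{skew}}_{\alpha,\beta}(f_1,f_2)=\left(f_1^e+\tfrac{2\alpha}{\gamma^2}k_1-\tfrac12k_2,\ f_2^e+\tfrac{2\beta}{\gamma^2}k_1+\tfrac12k_2\right),\quad k_1=\alpha f_1^o+\beta f_2^o,\quad k_2=f_1^e-f_2^e.$$ (b) The map $P^{\mathrm{skew}}_{\alpha,\beta}$ is a projection on the space $$\mathcal C^{\mathrm{skew}}_{\alpha,\beta}=\{(g_1,g_2)\in\mathcal C:\ g_1^e=g_2^e,\ \beta g_1^o=\alpha g_2^o\}.$$ (c) The space $\mathcal C^{\mathrm{skew}}_{\alpha,\beta}$ is precisely the subspace of extensions related to the skew Brownian motion generated by $A^{\mathrm{skew}}_{\alpha,\beta}$, that is, $\mathcal C^{\mathrm{skew}}_{\alpha,\beta}=\{E^{\mathrm{skew}}_{\alpha,\beta}f:\ f\in\mathfrak C[-\infty,\infty]\}$.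
   Context: $\mathfrak C[-\infty,\infty]$ is the space of real continuous functions on $\mathbb R$ with finite limits at $\pm\infty$ (supremum norm); $\mathcal C=(\mathfrak C[-\infty,\infty])^2$ with a usual product norm (e.g. maximum norm). For a function $f$ on $\mathbb R$: $f^{T}(x)=f(-x)$, $f^e=\frac12(f+f^{T})$, $f^o=\frac12(f-f^{T})$. $\sinh_a(x)=\sinh(ax)$, $\cosh_a(x)=\cosh(ax)$; $(f*g)(x)=\int_0^xf(x-y)g(y)\,dy$ for all $x\in\mathbb R$; $\widehat f(\lambda)=\int_0^\infty e^{-\lambda x}f(x)\,dx$. For any $\alpha,\beta\ge0$ with $\alpha+\beta>0$, with $\gamma=\sqrt{2(\alpha^2+\beta^2)}$, the operator $P_{\alpha,\beta}:\mathcal C\to\mathcal C$ is defined as follows: for $(f_1,f_2)\in\mathcal C$ put $k_1=\alpha f_1^o+\beta f_2^o$, $k_2=f_1^e-f_2^e$, $c=\widehat{k_1}(\gamma)+\frac\gamma2\widehat{k_2}(\gamma)$; then $P_{\alpha,\beta}(f_1,f_2)=(g_1,g_2)$ with, on $\mathbb R$, $$g_1=f_1^e+c\left(\tfrac{2\alpha}{\gamma}\sinh_\gamma-\cosh_\gamma\right)-\left(\tfrac{2\alpha}{\gamma}k_1-\tfrac{\gamma}{2}k_2\right)*\sinh_\gamma+(k_1-\alpha k_2)*\cosh_\gamma,$$ $$g_2=f_2^e+c\left(\tfrac{2\beta}{\gamma}\sinh_\gamma+\cosh_\gamma\right)-\left(\tfrac{2\beta}{\gamma}k_1+\tfrac{\gamma}{2}k_2\right)*\sinh_\gamma-(k_1+\beta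 k_2)*\cosh_\gamma.$$ $P_{n\alpha,n\beta}$ is the same operator with $(\alpha,\beta)$ replaced by $(n\alpha,n\beta)$ throughout (including in $\gamma$, $k_1$, $c$). $E^{\mathrm{skew}}_{\alpha,\beta}:\mathfrak C[-\infty,\infty]\to\mathcal C$, $E^{\mathrm{skew}}_{\alpha,\beta}f=(\widetilde{f_\ell},\widetilde{f_{\mathrm r}})$, is the extension operator for the skew Brownian motion: $\widetilde{f_\ell}(x)=f(x)$ for $x\le0$, $\widetilde{f_\ell}(x)=\frac{\beta-\alpha}{\alpha+\beta}f(-x)+\frac{2\alpha}{\alpha+\beta}f(x)$ for $x>0$; $\widetilde{f_{\mathrm r}}(x)=\frac{2\beta}{\alpha+\beta}f(x)+\frac{\alpha-\beta}{\alpha+\beta}f(-x)$ for $x<0$, $\widetilde{f_{\mathrm r}}(x)=f(x)$ for $x\ge0$. The cosine family generated by the skew Brownian motion generator $A^{\mathrm{skew}}_{\alpha,\beta}$ (the second derivative in $\mathfrak C[-\infty,\infty]$ with transmission condition $\alpha f'(0+)=\beta f'(0-)$, $f''(0+)=f''(0-)$) is obtained by applying $\frac12[g(x+t)+g(x-t)]$ to both coordinates of $E^{\mathrm{skew}}_{\alpha,\beta}f$ and taking the first coordinate for $x<0$ and the second for $x>0$; the "subspace of extensions" is the range of $E^{\mathrm{skew}}_{\alpha,\beta}$. A projection on a subspace is an idempotent bounded linear operator with that subspace as range. *)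

theory Defs
  imports "HOL-Analysis.Analysis"
begin

section \<open>The space of continuous functions with finite limits at both infinities\<close>

definition cinf_fun :: "(real \<Rightarrow> real) \<Rightarrow> bool"
  where "cinf_fun f \<longleftrightarrow> continuous_on UNIV f \<and>
    (\<exists>l. (f \<longlongrightarrow> l) at_top) \<and> (\<exists>l. (f \<longlongrightarrow> l) at_bot)"

typedef cinf = "{f. cinf_fun f}"
  morphisms apply_cinf Abs_cinf
  by (rule exI[of _ "\<lambda>_. 0"]) (auto simp: cinf_fun_def)

setup_lifting type_definition_cinf

lemma cinf_fun_apply: "cinf_fun (apply_cinf f)"
  using apply_cinf[of f] by simp

lemma apply_Abs_cinf: "cinf_fun f \<Longrightarrow> apply_cinf (Abs_cinf f) = f"
  by (simp add: Abs_cinf_inverse)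

lemma cinf_eqI: "(\<And>x. apply_cinf f x = apply_cinf g x) \<Longrightarrow> f = g"
  by (metis apply_cinf_inject ext)

lemma cinf_bounded:
  assumes "cinf_fun f" shows "\<exists>B. \<forall>x. \<bar>f x\<bar> \<le> B"
proof -
  obtain l m where l: "(f \<longlongrightarrow> l) at_top" and m: "(f \<longlongrightarrow> m) at_bot"
    and c: "continuous_on UNIV f" using assms by (auto simp: cinf_fun_def)
  have "\<forall>\<^sub>F x in at_top. \<bar>f x - l\<bar> < 1" using tendstoD[OF l, of 1] by (simp add: dist_real_def)
  then obtain a where a: "\<And>x. x \<ge> a \<Longrightarrow> \<bar>f x - l\<bar> < 1"
    by (auto simp: eventually_at_top_linorder)
  have "\<forall>\<^sub>F x in at_bot. \<bar>f x - m\<bar> < 1" using tendstoD[OF m, of 1] by (simp add: dist_real_def)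
  then obtain b where b: "\<And>x. x \<le> b \<Longrightarrow> \<bar>f x - m\<bar> < 1"
    by (auto simp: eventually_at_bot_linorder)
  have "compact (f ` {b..a})"
    by (intro compact_continuous_image continuous_on_subset[OF c]) auto
  then obtain C where C: "\<And>x. b \<le> x \<Longrightarrow> x \<le> a \<Longrightarrow> \<bar>f x\<bar> \<le> C"
    using compact_imp_bounded by (force simp: bounded_iff)
  have "\<bar>f x\<bar> \<le> max C (max (\<bar>l\<bar> + 1) (\<bar>m\<bar> + 1))" for x
    using a[of x] b[of x] C[of x] by (cases "x \<ge> a"; cases "x \<le> b") auto
  then show ?thesis by blast
qed

lemma cinf_bdd_above [simp]: "bdd_above (range (\<lambda>x. \<bar>apply_cinf f x\<bar>))"
  using cinf_bounded[OF cinf_fun_apply[of f]] by (auto simp: bdd_above_def)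

lemma cinf_fun_add: "cinf_fun f \<Longrightarrow> cinf_fun g \<Longrightarrow> cinf_fun (\<lambda>x. f x + g x)"
  unfolding cinf_fun_def by (blast intro: continuous_on_add tendsto_add)

lemma cinf_fun_diff: "cinf_fun f \<Longrightarrow> cinf_fun g \<Longrightarrow> cinf_fun (\<lambda>x. f x - g x)"
  unfolding cinf_fun_def by (blast intro: continuous_on_diff tendsto_diff)

lemma cinf_fun_scale: "cinf_fun f \<Longrightarrow> cinf_fun (\<lambda>x. r * f x)"
  unfolding cinf_fun_def by (blast intro: continuous_on_mult_left tendsto_mult_left)

lemma cinf_fun_uminus: "cinf_fun f \<Longrightarrow> cinf_fun (\<lambda>x. - f x)"
  unfolding cinf_fun_def by (blast intro: continuous_on_minus tendsto_minus)

lemma cinf_fun_reflect: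
  assumes "cinf_fun f" shows "cinf_fun (\<lambda>x. f (- x))"
proof -
  have "continuous_on UNIV (\<lambda>x. f (- x))"
    using assms by (auto simp: cinf_fun_def intro!: continuous_on_compose2[of UNIV f] continuous_intros)
  then show ?thesis
    using assms unfolding cinf_fun_def filterlim_at_bot_mirror by simp
qed

instantiation cinf :: real_vector
begin

lift_definition zero_cinf :: cinf is "\<lambda>_. 0" by (auto simp: cinf_fun_def)
lift_definition plus_cinf :: "cinf \<Rightarrow> cinf \<Rightarrow> cinf" is "\<lambda>f g x. f x + g x"
  by (rule cinf_fun_add)
lift_definition minus_cinf :: "cinf \<Rightarrow> cinf \<Rightarrow> cinf" is "\<lambda>f g x. f x - g x"
  by (rule cinf_fun_diff)
lift_definition uminus_cinf :: "cinf \<Rightarrow> cinf" is "\<lambda>f x. - f x"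
  by (rule cinf_fun_uminus)
lift_definition scaleR_cinf :: "real \<Rightarrow> cinf \<Rightarrow> cinf" is "\<lambda>r f x. r * f x"
  by (rule cinf_fun_scale)

lemmas cinf_rep_eq [simp] = zero_cinf.rep_eq plus_cinf.rep_eq minus_cinf.rep_eq
  uminus_cinf.rep_eq scaleR_cinf.rep_eq

instance
  by standard (auto intro!: cinf_eqI simp: algebra_simps)

end

instantiation cinf :: real_normed_vector
begin

definition norm_cinf :: "cinf \<Rightarrow> real" where "norm_cinf f = (SUP x. \<bar>apply_cinf f x\<bar>)"
definition dist_cinf :: "cinf \<Rightarrow> cinf \<Rightarrow> real" where "dist_cinf f g = norm (f - g)"
definition sgn_cinf :: "cinf \<Rightarrow> cinf" where "sgn_cinf f = f /\<^sub>R norm f"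
definition uniformity_cinf :: "(cinf \<times> cinf) filter"
  where "uniformity_cinf = (INF e\<in>{0 <..}. principal {(x, y). dist x y < e})"
definition open_cinf :: "cinf set \<Rightarrow> bool"
  where "open_cinf S = (\<forall>x\<in>S. \<forall>\<^sub>F (x', y) in uniformity. x' = x \<longrightarrow> y \<in> S)"

lemma cinf_abs_le_norm: "\<bar>apply_cinf f x\<bar> \<le> norm f"
  unfolding norm_cinf_def by (rule cSUP_upper) auto

lemma cinf_norm_le: "(\<And>x. \<bar>apply_cinf f x\<bar> \<le> B) \<Longrightarrow> norm f \<le> B"
  unfolding norm_cinf_def by (rule cSUP_least) auto

instance
proof
  fix f g h :: cinf and r s :: real
  show "norm f = 0 \<longleftrightarrow> f = 0"
  proof
    assume "norm f = 0"
    then show "f = 0" using cinf_abs_le_norm[of f] by (intro cinf_eqI) auto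
  next
    assume "f = 0" then show "norm f = 0" by (simp add: norm_cinf_def)
  qed
  show "norm (f + g) \<le> norm f + norm g"
  proof (rule cinf_norm_le)
    fix x
    show "\<bar>apply_cinf (f + g) x\<bar> \<le> norm f + norm g"
      using cinf_abs_le_norm[of f x] cinf_abs_le_norm[of g x] by simp
  qed
  have le: "norm (r *\<^sub>R f) \<le> \<bar>r\<bar> * norm f" for r and f :: cinf
    using cinf_abs_le_norm[of f] by (intro cinf_norm_le) (simp add: abs_mult mult_left_mono)
  show "norm (r *\<^sub>R f) = \<bar>r\<bar> * norm f"
  proof (cases "r = 0")
    case True
    then show ?thesis by (simp add: norm_cinf_def)
  next
    case False
    have "inverse r *\<^sub>R (r *\<^sub>R f) = f" using False by (intro cinf_eqI) simp
    then have "norm f \<le> \<bar>inverse r\<bar> * norm (r *\<^sub>R f)" using le[of "inverse r" "r *\<^sub>R f"] by simp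
    then have "\<bar>r\<bar> * norm f \<le> norm (r *\<^sub>R f)" using False by (simp add: field_simps)
    with le[of r f] show ?thesis by simp
  qed
qed (simp_all add: dist_cinf_def sgn_cinf_def uniformity_cinf_def open_cinf_def)

end

declare [[coercion "apply_cinf :: cinf \<Rightarrow> real \<Rightarrow> real"]]

section \<open>Even and odd parts, convolution, Laplace transform\<close>

lift_definition reflect :: "cinf \<Rightarrow> cinf" is "\<lambda>f x. f (- x)"
  by (rule cinf_fun_reflect)

lemmas reflect_rep_eq [simp] = reflect.rep_eq

definition even_part :: "cinf \<Rightarrow> cinf" where "even_part f = (1/2) *\<^sub>R (f + reflect f)"
definition odd_part :: "cinf \<Rightarrow> cinf" where "odd_part f = (1/2) *\<^sub>R (f - reflect f)"

text \<open>The interval integral is oriented: for \<open>x < 0\<close> it is minus the integral over \<open>[x, 0]\<close>.\<close>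

definition convol :: "(real \<Rightarrow> real) \<Rightarrow> (real \<Rightarrow> real) \<Rightarrow> real \<Rightarrow> real"
  where "convol f g x = (LBINT y=0..x. f (x - y) * g y)"

definition laplace :: "(real \<Rightarrow> real) \<Rightarrow> real \<Rightarrow> real"
  where "laplace f s = (LBINT x=0..\<infinity>. exp (- s * x) * f x)"

section \<open>The operators\<close>

definition gam :: "real \<Rightarrow> real \<Rightarrow> real"
  where "gam \<alpha> \<beta> = sqrt (2 * (\<alpha>\<^sup>2 + \<beta>\<^sup>2))"

definition k1 :: "real \<Rightarrow> real \<Rightarrow> cinf \<Rightarrow> cinf \<Rightarrow> cinf"
  where "k1 \<alpha> \<beta> f\<^sub>1 f\<^sub>2 = \<alpha> *\<^sub>R odd_part f\<^sub>1 + \<beta> *\<^sub>R odd_part f\<^sub>2"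

definition k2 :: "cinf \<Rightarrow> cinf \<Rightarrow> cinf"
  where "k2 f\<^sub>1 f\<^sub>2 = even_part f\<^sub>1 - even_part f\<^sub>2"

definition c_const :: "real \<Rightarrow> real \<Rightarrow> cinf \<Rightarrow> cinf \<Rightarrow> real"
  where "c_const \<alpha> \<beta> f\<^sub>1 f\<^sub>2 =
    laplace (k1 \<alpha> \<beta> f\<^sub>1 f\<^sub>2) (gam \<alpha> \<beta>) + gam \<alpha> \<beta> / 2 * laplace (k2 f\<^sub>1 f\<^sub>2) (gam \<alpha> \<beta>)"

definition P_left :: "real \<Rightarrow> real \<Rightarrow> cinf \<Rightarrow> cinf \<Rightarrow> real \<Rightarrow> real"
  where "P_left \<alpha> \<beta> f\<^sub>1 f\<^sub>2 x =
    (let \<gamma> = gam \<alpha> \<beta>; \<kappa>\<^sub>1 = k1 \<alpha> \<beta> f\<^sub>1 f\<^sub>2; \<kappa>\<^sub>2 = k2 f\<^sub>1 f\<^sub>2; c = c_const \<alpha> \<beta> f\<^sub>1 f\<^sub>2 in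
      even_part f\<^sub>1 x + c * (2 * \<alpha> / \<gamma> * sinh (\<gamma> * x) - cosh (\<gamma> * x))
      - convol (\<lambda>y. 2 * \<alpha> / \<gamma> * \<kappa>\<^sub>1 y - \<gamma> / 2 * \<kappa>\<^sub>2 y) (\<lambda>y. sinh (\<gamma> * y)) x
      + convol (\<lambda>y. \<kappa>\<^sub>1 y - \<alpha> * \<kappa>\<^sub>2 y) (\<lambda>y. cosh (\<gamma> * y)) x)"

definition P_right :: "real \<Rightarrow> real \<Rightarrow> cinf \<Rightarrow> cinf \<Rightarrow> real \<Rightarrow> real"
  where "P_right \<alpha> \<beta> f\<^sub>1 f\<^sub>2 x =
    (let \<gamma> = gam \<alpha> \<beta>; \<kappa>\<^sub>1 = k1 \<alpha> \<beta> f\<^sub>1 f\<^sub>2; \<kappa>\<^sub>2 = k2 f\<^sub>1 f\<^sub>2; c = c_const \<alpha> \<beta> f\<^sub>1 f\<^sub>2 in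
      even_part f\<^sub>2 x + c * (2 * \<beta> / \<gamma> * sinh (\<gamma> * x) + cosh (\<gamma> * x))
      - convol (\<lambda>y. 2 * \<beta> / \<gamma> * \<kappa>\<^sub>1 y + \<gamma> / 2 * \<kappa>\<^sub>2 y) (\<lambda>y. sinh (\<gamma> * y)) x
      - convol (\<lambda>y. \<kappa>\<^sub>1 y + \<beta> * \<kappa>\<^sub>2 y) (\<lambda>y. cosh (\<gamma> * y)) x)"

text \<open>For \<open>\<alpha>, \<beta> \<ge> 0\<close> with \<open>\<alpha> + \<beta> > 0\<close> the two functions above belong to the space, by the
  choice of the constant \<open>c_const\<close>; see \<open>P_well_defined\<close> below. For such parameters \<open>Abs_cinf\<close>
  is applied only to functions on which it inverts \<open>apply_cinf\<close>.\<close>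

definition P_op :: "real \<Rightarrow> real \<Rightarrow> cinf \<times> cinf \<Rightarrow> cinf \<times> cinf"
  where "P_op \<alpha> \<beta> = (\<lambda>(f\<^sub>1, f\<^sub>2). (Abs_cinf (P_left \<alpha> \<beta> f\<^sub>1 f\<^sub>2), Abs_cinf (P_right \<alpha> \<beta> f\<^sub>1 f\<^sub>2)))"

definition P_skew :: "real \<Rightarrow> real \<Rightarrow> cinf \<times> cinf \<Rightarrow> cinf \<times> cinf"
  where "P_skew \<alpha> \<beta> = (\<lambda>(f\<^sub>1, f\<^sub>2).
    (even_part f\<^sub>1 + (2 * \<alpha> / (gam \<alpha> \<beta>)\<^sup>2) *\<^sub>R k1 \<alpha> \<beta> f\<^sub>1 f\<^sub>2 - (1/2) *\<^sub>R k2 f\<^sub>1 f\<^sub>2,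
     even_part f\<^sub>2 + (2 * \<beta> / (gam \<alpha> \<beta>)\<^sup>2) *\<^sub>R k1 \<alpha> \<beta> f\<^sub>1 f\<^sub>2 + (1/2) *\<^sub>R k2 f\<^sub>1 f\<^sub>2))"

definition C_skew :: "real \<Rightarrow> real \<Rightarrow> (cinf \<times> cinf) set"
  where "C_skew \<alpha> \<beta> = {(g\<^sub>1, g\<^sub>2). even_part g\<^sub>1 = even_part g\<^sub>2 \<and>
    \<beta> *\<^sub>R odd_part g\<^sub>1 = \<alpha> *\<^sub>R odd_part g\<^sub>2}"

definition E_left :: "real \<Rightarrow> real \<Rightarrow> cinf \<Rightarrow> real \<Rightarrow> real"
  where "E_left \<alpha> \<beta> f x = (if x \<le> 0 then f x
    else (\<beta> - \<alpha>) / (\<alpha> + \<beta>) * f (- x) + 2 * \<alpha> / (\<alpha> + \<beta>) * f x)"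

definition E_right :: "real \<Rightarrow> real \<Rightarrow> cinf \<Rightarrow> real \<Rightarrow> real"
  where "E_right \<alpha> \<beta> f x = (if x < 0
    then 2 * \<beta> / (\<alpha> + \<beta>) * f x + (\<alpha> - \<beta>) / (\<alpha> + \<beta>) * f (- x) else f x)"

text \<open>The two functions above belong to the space whenever \<open>\<alpha> + \<beta> \<noteq> 0\<close>; see
  \<open>E_skew_well_defined\<close> below.\<close>

definition E_skew :: "real \<Rightarrow> real \<Rightarrow> cinf \<Rightarrow> cinf \<times> cinf"
  where "E_skew \<alpha> \<beta> f = (Abs_cinf (E_left \<alpha> \<beta> f), Abs_cinf (E_right \<alpha> \<beta> f))"

definition projection_on :: "('a::real_normed_vector \<Rightarrow> 'a) \<Rightarrow> 'a set \<Rightarrow> bool"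
  where "projection_on Q S \<longleftrightarrow> bounded_linear Q \<and> (\<forall>x. Q (Q x) = Q x) \<and> range Q = S"

section \<open>Well-definedness of the operators\<close>

lemma tendsto_eq_eventually:
  "(f \<longlongrightarrow> l) F \<Longrightarrow> eventually (\<lambda>x. f x = g x) F \<Longrightarrow> (g \<longlongrightarrow> l) F"
  using tendsto_cong by blast

lemma E_skew_well_defined:
  assumes "\<alpha> + \<beta> \<noteq> 0"
  shows "cinf_fun (E_left \<alpha> \<beta> f)" "cinf_fun (E_right \<alpha> \<beta> f)"
proof -
  have f: "cinf_fun (apply_cinf f)" by (rule cinf_fun_apply)
  have c: "continuous_on S (apply_cinf f)" for S
    using f by (auto simp: cinf_fun_def intro: continuous_on_subset)
  have c': "continuous_on S (\<lambda>x. apply_cinf f (- x))" for S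
    using cinf_fun_reflect[OF f] by (auto simp: cinf_fun_def intro: continuous_on_subset)
  have glue: "cinf_fun (\<lambda>x. if x \<le> 0 then g x else h x)"
    if gh: "cinf_fun g" "cinf_fun h" "g 0 = h 0" for g h :: "real \<Rightarrow> real"
  proof -
    have "continuous_on ({..0} \<union> {0..}) (\<lambda>x. if x \<le> 0 then g x else h x)"
      using that by (intro continuous_on_If) (auto simp: cinf_fun_def intro: continuous_on_subset)
    moreover have "{..0::real} \<union> {0..} = UNIV" by auto
    moreover obtain l where "(h \<longlongrightarrow> l) at_top" using gh by (auto simp: cinf_fun_def)
    then have "((\<lambda>x. if x \<le> 0 then g x else h x) \<longlongrightarrow> l) at_top"
      by (rule tendsto_eq_eventually, intro eventually_mono[OF eventually_gt_at_top[of 0]]) auto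
    moreover obtain m where "(g \<longlongrightarrow> m) at_bot" using gh by (auto simp: cinf_fun_def)
    then have "((\<lambda>x. if x \<le> 0 then g x else h x) \<longlongrightarrow> m) at_bot"
      by (rule tendsto_eq_eventually, intro eventually_mono[OF eventually_le_at_bot[of 0]]) auto
    ultimately show ?thesis unfolding cinf_fun_def by auto
  qed
  have z: "(\<beta> - \<alpha>) / (\<alpha> + \<beta>) * z + 2 * \<alpha> / (\<alpha> + \<beta>) * z = z"
    "2 * \<beta> / (\<alpha> + \<beta>) * z + (\<alpha> - \<beta>) / (\<alpha> + \<beta>) * z = z" for z
    unfolding distrib_right[symmetric] add_divide_distrib[symmetric]
    using assms by (simp_all add: add.commute)
  have "cinf_fun (\<lambda>x. if x \<le> 0 then f x
    else (\<beta> - \<alpha>) / (\<alpha> + \<beta>) * f (- x) + 2 * \<alpha> / (\<alpha> + \<beta>) * f x)"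
    by (intro glue cinf_fun_add cinf_fun_scale cinf_fun_reflect f) (use z[of "f 0"] in simp)
  then show "cinf_fun (E_left \<alpha> \<beta> f)" by (simp add: E_left_def[abs_def])
  have "cinf_fun (\<lambda>x. if x \<le> 0
    then 2 * \<beta> / (\<alpha> + \<beta>) * f x + (\<alpha> - \<beta>) / (\<alpha> + \<beta>) * f (- x) else f x)"
    by (intro glue cinf_fun_add cinf_fun_scale cinf_fun_reflect f) (use z[of "f 0"] in simp)
  also have "(\<lambda>x. if x \<le> 0 then 2 * \<beta> / (\<alpha> + \<beta>) * f x + (\<alpha> - \<beta>) / (\<alpha> + \<beta>) * f (- x) else f x)
    = E_right \<alpha> \<beta> f"
    by (intro ext) (use z[of "f 0"] in \<open>auto simp: E_right_def order_less_le\<close>)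
  finally show "cinf_fun (E_right \<alpha> \<beta> f)" .
qed

lemma ex_antiderivative:
  fixes h :: "real \<Rightarrow> real"
  assumes "continuous_on UNIV h"
  obtains H where "\<And>x. (H has_real_derivative h x * exp (t * x)) (at x)" "H 0 = 0"
proof -
  have "continuous_on UNIV (\<lambda>x. h x * exp (t * x))"
    by (intro continuous_intros assms)
  then have "\<exists>F. \<forall>x::real. -\<infinity> < ereal x \<longrightarrow> ereal x < \<infinity> \<longrightarrow>
      (F has_vector_derivative h x * exp (t * x)) (at x)"
    by (intro einterval_antiderivative) (auto simp: continuous_on_eq_continuous_at)
  then obtain F where "\<And>x. (F has_real_derivative h x * exp (t * x)) (at x)"
    by (auto simp: has_real_derivative_iff_has_vector_derivative)
  then have "\<And>x. ((\<lambda>x. F x - F 0) has_real_derivative h x * exp (t * x)) (at x)"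
    by (auto intro!: derivative_eq_intros)
  then show ?thesis by (rule that) simp
qed

lemma convol_exp:
  fixes h :: "real \<Rightarrow> real"
  assumes c: "continuous_on UNIV h"
    and K: "\<And>x. (K has_real_derivative h x * exp (- s * x)) (at x)" and K0: "K 0 = 0"
  shows "(LBINT y=0..ereal x. h (x - y) * exp (s * y)) = exp (s * x) * K x"
proof -
  have "(LBINT y=ereal 0..ereal x. h (x - y) * exp (s * y))
      = (- exp (s * x) * K (x - x)) - (- exp (s * x) * K (x - 0))"
  proof (rule interval_integral_FTC_finite)
    show "continuous_on {min 0 x..max 0 x} (\<lambda>y. h (x - y) * exp (s * y))"
      by (intro continuous_intros continuous_on_compose2[OF c]) auto
    fix y
    have "((\<lambda>y. - exp (s * x) * K (x - y)) has_real_derivative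
       - exp (s * x) * ((h (x - y) * exp (- s * (x - y))) * (- 1))) (at y)"
      by (rule derivative_eq_intros DERIV_chain2[OF K] refl | simp)+
    also have "- exp (s * x) * ((h (x - y) * exp (- s * (x - y))) * (- 1)) = h (x - y) * exp (s * y)"
      by (simp add: mult.left_commute exp_add[symmetric] algebra_simps)
    finally show "((\<lambda>y. - exp (s * x) * K (x - y)) has_vector_derivative h (x - y) * exp (s * y))
      (at y within {min 0 x..max 0 x})"
      by (auto simp: has_real_derivative_iff_has_vector_derivative
          intro: has_vector_derivative_at_within)
  qed
  then show ?thesis by (simp add: K0 zero_ereal_def)
qed

lemma convol_sinh_cosh:
  fixes h :: "real \<Rightarrow> real"
  assumes c: "continuous_on UNIV h"
    and K: "\<And>x. (K has_real_derivative h x * exp (- s * x)) (at x)" and K0: "K 0 = 0"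
    and L: "\<And>x. (L has_real_derivative h x * exp (s * x)) (at x)" and L0: "L 0 = 0"
  shows "convol h (\<lambda>y. sinh (s * y)) x = (exp (s * x) * K x - exp (- s * x) * L x) / 2"
    and "convol h (\<lambda>y. cosh (s * y)) x = (exp (s * x) * K x + exp (- s * x) * L x) / 2"
proof -
  have int: "interval_lebesgue_integrable lborel (ereal 0) (ereal x) (\<lambda>y. h (x - y) * exp (t * y))"
    for t
  proof (rule interval_integrable_isCont)
    have "continuous_on UNIV (\<lambda>y. h (x - y) * exp (t * y))"
      by (intro continuous_intros continuous_on_compose2[OF c]) auto
    then show "isCont (\<lambda>y. h (x - y) * exp (t * y)) y" for y
      by (simp add: continuous_on_eq_continuous_at)
  qed
  note i = int[unfolded zero_ereal_def[symmetric]]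
  note e1 = convol_exp[OF c K K0, of x]
  note e2 = convol_exp[OF c, of L "- s", OF _ L0, of x]
  have e2: "(LBINT y=0..ereal x. h (x - y) * exp (- s * y)) = exp (- s * x) * L x"
    by (rule e2) (use L in simp)
  have "convol h (\<lambda>y. sinh (s * y)) x =
    (LBINT y=0..ereal x. (h (x - y) * exp (s * y)) / 2 - (h (x - y) * exp (- s * y)) / 2)"
    unfolding convol_def by (simp add: sinh_field_def algebra_simps diff_divide_distrib)
  also have "\<dots> = (exp (s * x) * K x - exp (- s * x) * L x) / 2"
    using i[of s] i[of "- s"] e1 e2
    by (subst interval_lebesgue_integral_diff) (auto simp: diff_divide_distrib)
  finally show "convol h (\<lambda>y. sinh (s * y)) x = (exp (s * x) * K x - exp (- s * x) * L x) / 2" .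
  have "convol h (\<lambda>y. cosh (s * y)) x =
    (LBINT y=0..ereal x. (h (x - y) * exp (s * y)) / 2 + (h (x - y) * exp (- s * y)) / 2)"
    unfolding convol_def by (simp add: cosh_field_def algebra_simps add_divide_distrib)
  also have "\<dots> = (exp (s * x) * K x + exp (- s * x) * L x) / 2"
    using i[of s] i[of "- s"] e1 e2
    by (subst interval_lebesgue_integral_add) (auto simp: add_divide_distrib)
  finally show "convol h (\<lambda>y. cosh (s * y)) x = (exp (s * x) * K x + exp (- s * x) * L x) / 2" .
qed

lemma laplace_integrable:
  assumes h: "cinf_fun h" and s: "s > 0"
  shows "set_integrable lborel {0..} (\<lambda>x. exp (- s * x) * h x)"
proof -
  obtain B where B: "\<And>x. \<bar>h x\<bar> \<le> B" using cinf_bounded[OF h] by auto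
  have c: "continuous_on UNIV h" using h by (simp add: cinf_fun_def)
  have "set_integrable lebesgue {0..} (\<lambda>x. exp (- s * x))"
    using s by (intro nonnegative_absolutely_integrable_1 integrable_on_exp_minus_to_infinity) auto
  then have "set_integrable lborel {0..} (\<lambda>x. exp (- s * x))"
    unfolding set_integrable_def by (subst (asm) integrable_completion) auto
  then have "set_integrable lborel {0..} (\<lambda>x. B * exp (- s * x))"
    by (rule set_integrable_mult_right)
  then show ?thesis
  proof (rule set_integrable_bound)
    have "(\<lambda>x. exp (- s * x) * h x) \<in> borel_measurable borel"
      by (intro borel_measurable_continuous_onI continuous_intros c)
    then show "set_borel_measurable lborel {0..} (\<lambda>x. exp (- s * x) * h x)"
      unfolding set_borel_measurable_def by measurable
    have "\<bar>h x\<bar> \<le> \<bar>B\<bar>" for x using B[of x] by linarith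
    then show "AE x in lborel. x \<in> {0..} \<longrightarrow> norm (exp (- s * x) * h x) \<le> norm (B * exp (- s * x))"
      by (auto simp: abs_mult mult.commute intro!: mult_right_mono)
  qed
qed

lemma laplace_limit:
  assumes h: "cinf_fun h" and s: "s > 0"
    and K: "\<And>x. (K has_real_derivative h x * exp (- s * x)) (at x)" and K0: "K 0 = 0"
  shows "(K \<longlongrightarrow> laplace h s) at_top"
proof -
  have c: "continuous_on UNIV h" using h by (simp add: cinf_fun_def)
  have lap: "laplace h s = (LBINT x:{0..}. exp (- s * x) * h x)"
    unfolding laplace_def zero_ereal_def interval_integral_to_infinity_eq set_lebesgue_integral_def
  proof (rule integral_cong_AE)
    have [measurable]: "(\<lambda>x. exp (- s * x) * h x) \<in> borel_measurable borel"
      by (intro borel_measurable_continuous_onI continuous_intros c)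
    show "(\<lambda>x. indicat_real {0<..} x *\<^sub>R (exp (- s * x) * h x)) \<in> borel_measurable lborel"
      "(\<lambda>x. indicat_real {0..} x *\<^sub>R (exp (- s * x) * h x)) \<in> borel_measurable lborel"
      by measurable
    show "AE x in lborel. indicat_real {0<..} x *\<^sub>R (exp (- s * x) * h x)
        = indicat_real {0..} x *\<^sub>R (exp (- s * x) * h x)"
      using AE_lborel_singleton[of "0::real"]
      by eventually_elim (auto simp: indicator_def)
  qed
  have "((\<lambda>b. LBINT x:{0..b}. exp (- s * x) * h x) \<longlongrightarrow> laplace h s) at_top"
    unfolding lap by (rule tendsto_set_lebesgue_integral_at_top[OF _ laplace_integrable[OF h s]]) simp
  moreover have "eventually (\<lambda>b. (LBINT x:{0..b}. exp (- s * x) * h x) = K b) at_top"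
    using eventually_ge_at_top[of 0]
  proof eventually_elim
    case (elim b)
    have "(LBINT x=ereal 0..ereal b. exp (- s * x) * h x) = K b - K 0"
    proof (rule interval_integral_FTC_finite)
      show "continuous_on {min 0 b..max 0 b} (\<lambda>x. exp (- s * x) * h x)"
        by (intro continuous_intros continuous_on_subset[OF c]) auto
      show "(K has_vector_derivative exp (- s * x) * h x) (at x within {min 0 b..max 0 b})" for x
        using has_vector_derivative_at_within[OF K[of x,
            unfolded has_real_derivative_iff_has_vector_derivative]] by (simp only: mult.commute)
    qed
    then show ?case using elim K0 by (simp add: interval_integral_Icc)
  qed
  ultimately show ?thesis by (rule tendsto_eq_eventually)
qed

lemma exp_decay:
  assumes "s > (0::real)" shows "((\<lambda>x. exp (- s * x)) \<longlongrightarrow> 0) at_top"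
proof (rule filterlim_compose[OF exp_at_bot])
  have "filterlim (\<lambda>x. s * x) at_top at_top"
    using assms by (intro filterlim_tendsto_pos_mult_at_top[OF tendsto_const] filterlim_ident)
  then show "filterlim (\<lambda>x. - s * x) at_bot at_top"
    by (simp add: filterlim_uminus_at_top)
qed

lemma limit_exp_K:
  assumes h: "(h \<longlongrightarrow> l) at_top" and s: "s > (0::real)"
    and K: "\<And>x. (K has_real_derivative h x * exp (- s * x)) (at x)"
    and lim: "(K \<longlongrightarrow> m) at_top"
  shows "((\<lambda>x. exp (s * x) * (K x - m)) \<longlongrightarrow> - (l / s)) at_top"
proof -
  have "((\<lambda>x. (K (inverse x) - m) / exp (- s * inverse x)) \<longlongrightarrow> - (l / s)) (at_right 0)"
  proof (rule lhopital_right)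
    show "((\<lambda>x. K (inverse x) - m) \<longlongrightarrow> 0) (at_right 0)"
      using lim unfolding filterlim_at_top_to_right[of K] by (simp add: LIM_zero)
    have "((\<lambda>x. exp (- s * x)) \<longlongrightarrow> 0) at_top"
      using s by (rule exp_decay)
    then show "((\<lambda>x. exp (- s * inverse x)) \<longlongrightarrow> 0) (at_right 0)"
      unfolding filterlim_at_top_to_right[of "\<lambda>x. exp (- s * x)"] .
    show "\<forall>\<^sub>F x in at_right 0. exp (- s * inverse x) \<noteq> 0" by simp
    have pos: "\<forall>\<^sub>F x in at_right 0. x > (0::real)" by (simp add: eventually_at_right_less)
    show "\<forall>\<^sub>F x in at_right 0. exp (- s * inverse x) * (s / x\<^sup>2) \<noteq> 0"
      using pos by eventually_elim (use s in auto)
    show "\<forall>\<^sub>F x in at_right 0. ((\<lambda>x. K (inverse x) - m) has_real_derivative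
        h (inverse x) * exp (- s * inverse x) * (- (1 / x\<^sup>2))) (at x)"
      using pos
    proof eventually_elim
      case (elim x)
      have "(inverse has_real_derivative - (1 / x\<^sup>2)) (at x)"
        using elim by (auto intro!: derivative_eq_intros simp: power2_eq_square field_simps)
      from DERIV_chain2[OF K this] show ?case by (auto intro!: derivative_eq_intros)
    qed
    show "\<forall>\<^sub>F x in at_right 0. ((\<lambda>x. exp (- s * inverse x)) has_real_derivative
        exp (- s * inverse x) * (s / x\<^sup>2)) (at x)"
      using pos by eventually_elim
        (auto intro!: derivative_eq_intros simp: power2_eq_square field_simps)
    have "((\<lambda>x. - (h (inverse x) / s)) \<longlongrightarrow> - (l / s)) (at_right 0)"
      using h s unfolding filterlim_at_top_to_right[of h] by (auto intro!: tendsto_intros)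
    then show "((\<lambda>x. h (inverse x) * exp (- s * inverse x) * (- (1 / x\<^sup>2))
        / (exp (- s * inverse x) * (s / x\<^sup>2))) \<longlongrightarrow> - (l / s)) (at_right 0)"
      by (rule tendsto_eq_eventually) (rule eventually_mono[OF pos], use s in simp)
  qed
  then have "((\<lambda>x. (K x - m) / exp (- s * x)) \<longlongrightarrow> - (l / s)) at_top"
    unfolding filterlim_at_top_to_right[of "\<lambda>x. (K x - m) / exp (- s * x)"] .
  then show ?thesis by (simp add: exp_minus field_simps)
qed

lemma limit_exp_L:
  assumes h: "(h \<longlongrightarrow> l) at_top" and s: "s > (0::real)"
    and L: "\<And>x. (L has_real_derivative h x * exp (s * x)) (at x)"
  shows "((\<lambda>x. exp (- s * x) * L x) \<longlongrightarrow> l / s) at_top"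
proof -
  have "((\<lambda>x. L x / exp (s * x)) \<longlongrightarrow> l / s) at_top"
  proof (rule lhospital_at_top_at_top)
    show "filterlim (\<lambda>x. exp (s * x)) at_top at_top"
      using s by (intro filterlim_compose[OF exp_at_top]
        filterlim_tendsto_pos_mult_at_top[OF tendsto_const] filterlim_ident)
    show "\<forall>\<^sub>F x in at_top. s * exp (s * x) \<noteq> 0" using s by auto
    show "\<forall>\<^sub>F x in at_top. (L has_real_derivative h x * exp (s * x)) (at x)" using L by auto
    show "\<forall>\<^sub>F x in at_top. ((\<lambda>x. exp (s * x)) has_real_derivative s * exp (s * x)) (at x)"
      by (intro always_eventually allI) (auto intro!: derivative_eq_intros)
    show "((\<lambda>x. h x * exp (s * x) / (s * exp (s * x))) \<longlongrightarrow> l / s) at_top"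
      using h s by (auto intro!: tendsto_intros)
  qed
  then show ?thesis by (simp add: exp_minus field_simps)
qed

lemma hyp_conv_continuous_limit:
  fixes a b s :: real
  assumes h: "cinf_fun h" and m: "cinf_fun m" and s: "s > 0"
  defines "F \<equiv> \<lambda>x. a * sinh (s * x) + b * cosh (s * x)
      + convol h (\<lambda>y. sinh (s * y)) x + convol m (\<lambda>y. cosh (s * y)) x"
  shows "continuous_on UNIV F"
    and "a + b + laplace h s + laplace m s = 0 \<Longrightarrow> \<exists>l. (F \<longlongrightarrow> l) at_top"
proof -
  have ch: "continuous_on UNIV h" and cm: "continuous_on UNIV m"
    using h m by (auto simp: cinf_fun_def)
  obtain K where K: "\<And>x. (K has_real_derivative h x * exp (- s * x)) (at x)" "K 0 = 0"
    using ex_antiderivative[OF ch, of "- s"] by blast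
  obtain L where L: "\<And>x. (L has_real_derivative h x * exp (s * x)) (at x)" "L 0 = 0"
    using ex_antiderivative[OF ch, of "s"] by blast
  obtain M where M: "\<And>x. (M has_real_derivative m x * exp (- s * x)) (at x)" "M 0 = 0"
    using ex_antiderivative[OF cm, of "- s"] by blast
  obtain N where N: "\<And>x. (N has_real_derivative m x * exp (s * x)) (at x)" "N 0 = 0"
    using ex_antiderivative[OF cm, of "s"] by blast
  have F: "F = (\<lambda>x. a * sinh (s * x) + b * cosh (s * x)
      + (exp (s * x) * K x - exp (- s * x) * L x) / 2
      + (exp (s * x) * M x + exp (- s * x) * N x) / 2)"
    unfolding F_def convol_sinh_cosh(1)[OF ch K L] convol_sinh_cosh(2)[OF cm M N] ..
  have cont: "continuous_on UNIV K" "continuous_on UNIV L" "continuous_on UNIV M" "continuous_on UNIV N"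
    using K L M N by (meson DERIV_isCont continuous_at_imp_continuous_on)+
  show "continuous_on UNIV F" unfolding F by (intro continuous_intros cont) auto
  assume eq: "a + b + laplace h s + laplace m s = 0"
  obtain lh lm where lh: "(h \<longlongrightarrow> lh) at_top" and lm: "(m \<longlongrightarrow> lm) at_top"
    using h m by (auto simp: cinf_fun_def)
  have e0: "((\<lambda>x. exp (- s * x)) \<longlongrightarrow> 0) at_top"
    using s by (rule exp_decay)
  have "F = (\<lambda>x. (b - a) / 2 * exp (- s * x)
      + (exp (s * x) * (K x - laplace h s) - exp (- s * x) * L x) / 2
      + (exp (s * x) * (M x - laplace m s) + exp (- s * x) * N x) / 2)"
  proof
    fix x
    have a: "a = - b - laplace h s - laplace m s" using eq by linarith
    show "F x = (b - a) / 2 * exp (- s * x)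
      + (exp (s * x) * (K x - laplace h s) - exp (- s * x) * L x) / 2
      + (exp (s * x) * (M x - laplace m s) + exp (- s * x) * N x) / 2"
      unfolding F a by (simp add: sinh_field_def cosh_field_def field_simps)
  qed
  moreover have "((\<lambda>x. (b - a) / 2 * exp (- s * x)
      + (exp (s * x) * (K x - laplace h s) - exp (- s * x) * L x) / 2
      + (exp (s * x) * (M x - laplace m s) + exp (- s * x) * N x) / 2) \<longlongrightarrow>
      (b - a) / 2 * 0 + (- (lh / s) - lh / s) / 2 + (- (lm / s) + lm / s) / 2) at_top"
    by (intro tendsto_intros e0 limit_exp_K[OF lh s K(1) laplace_limit[OF h s K]]
        limit_exp_K[OF lm s M(1) laplace_limit[OF m s M]]
        limit_exp_L[OF lh s L(1)] limit_exp_L[OF lm s N(1)]) auto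
  ultimately show "\<exists>l. (F \<longlongrightarrow> l) at_top" by metis
qed

lemma convol_reflect:
  "convol h g (- x) = - convol (\<lambda>y. h (- y)) (\<lambda>y. g (- y)) x"
proof -
  have "convol h g (- x) = (LBINT y=ereal x..0. h (- x + y) * g (- y))"
    unfolding convol_def
    by (subst interval_integral_reflect) (simp add: algebra_simps)
  also have "\<dots> = - convol (\<lambda>y. h (- y)) (\<lambda>y. g (- y)) x"
    unfolding convol_def by (subst interval_integral_endpoints_reverse) (simp add: algebra_simps)
  finally show ?thesis .
qed

lemma convol_uminus: "convol (\<lambda>y. - h y) g x = - convol h g x"
  "convol h (\<lambda>y. - g y) x = - convol h g x"
  by (simp_all add: convol_def interval_lebesgue_integral_uminus)

lemma laplace_comb:
  assumes "cinf_fun h" "cinf_fun k" "s > 0"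
  shows "laplace (\<lambda>x. a * h x + b * k x) s = a * laplace h s + b * laplace k s"
proof -
  obtain K where K: "\<And>x. (K has_real_derivative h x * exp (- s * x)) (at x)" "K 0 = 0"
    using ex_antiderivative[of h "- s"] assms by (auto simp: cinf_fun_def)
  obtain L where L: "\<And>x. (L has_real_derivative k x * exp (- s * x)) (at x)" "L 0 = 0"
    using ex_antiderivative[of k "- s"] assms by (auto simp: cinf_fun_def)
  have "((\<lambda>x. a * K x + b * L x) \<longlongrightarrow> laplace (\<lambda>x. a * h x + b * k x) s) at_top"
    using assms K L by (intro laplace_limit cinf_fun_add cinf_fun_scale)
      (auto intro!: derivative_eq_intros simp: algebra_simps)
  moreover have "((\<lambda>x. a * K x + b * L x) \<longlongrightarrow> a * laplace h s + b * laplace k s) at_top"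
    by (intro tendsto_intros laplace_limit assms K L)
  ultimately show ?thesis by (rule tendsto_unique[rotated]) simp
qed

text \<open>Symmetry reduces the limit at minus infinity to the one at plus infinity with the
  coefficients \<open>a\<close> and \<open>p\<close> negated.\<close>

lemma hyp_conv_cinf_fun:
  assumes k: "cinf_fun k" "\<And>x. k (- x) = - k x" and m: "cinf_fun m" "\<And>x. m (- x) = m x"
    and s: "s > 0"
    and plus: "a + b + p * laplace k s + q * laplace m s + u * laplace k s + v * laplace m s = 0"
    and minus: "- a + b - p * laplace k s + q * laplace m s + u * laplace k s - v * laplace m s = 0"
  shows "cinf_fun (\<lambda>x. a * sinh (s * x) + b * cosh (s * x)
      + convol (\<lambda>y. p * k y + q * m y) (\<lambda>y. sinh (s * y)) x
      + convol (\<lambda>y. u * k y + v * m y) (\<lambda>y. cosh (s * y)) x)" (is "cinf_fun ?F")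
proof -
  have cf: "cinf_fun (\<lambda>y. p * k y + q * m y)" for p q
    by (intro cinf_fun_add cinf_fun_scale k m)
  have "continuous_on UNIV ?F" by (rule hyp_conv_continuous_limit(1)[OF cf cf s])
  moreover have "\<exists>l. (?F \<longlongrightarrow> l) at_top"
    by (rule hyp_conv_continuous_limit(2)[OF cf cf s])
      (use plus in \<open>simp add: laplace_comb[OF k(1) m(1) s]\<close>)
  moreover have "\<exists>l. ((\<lambda>x. (- a) * sinh (s * x) + b * cosh (s * x)
      + convol (\<lambda>y. (- p) * k y + q * m y) (\<lambda>y. sinh (s * y)) x
      + convol (\<lambda>y. u * k y + (- v) * m y) (\<lambda>y. cosh (s * y)) x) \<longlongrightarrow> l) at_top"
    by (rule hyp_conv_continuous_limit(2)[OF cf cf s])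
      (unfold laplace_comb[OF k(1) m(1) s], use minus in simp)
  moreover have "(\<lambda>x. (- a) * sinh (s * x) + b * cosh (s * x)
      + convol (\<lambda>y. (- p) * k y + q * m y) (\<lambda>y. sinh (s * y)) x
      + convol (\<lambda>y. u * k y + (- v) * m y) (\<lambda>y. cosh (s * y)) x) = (\<lambda>x. ?F (- x))"
  proof
    fix x
    have "convol (\<lambda>y. p * k y + q * m y) (\<lambda>y. sinh (s * y)) (- x)
        = convol (\<lambda>y. (- p) * k y + q * m y) (\<lambda>y. sinh (s * y)) x"
      unfolding convol_reflect by (simp add: k m convol_uminus)
    moreover have "convol (\<lambda>y. u * k y + v * m y) (\<lambda>y. cosh (s * y)) (- x)
        = convol (\<lambda>y. u * k y + (- v) * m y) (\<lambda>y. cosh (s * y)) x"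
      unfolding convol_reflect by (simp add: k m convol_uminus(1)[symmetric])
    ultimately show "(- a) * sinh (s * x) + b * cosh (s * x)
      + convol (\<lambda>y. (- p) * k y + q * m y) (\<lambda>y. sinh (s * y)) x
      + convol (\<lambda>y. u * k y + (- v) * m y) (\<lambda>y. cosh (s * y)) x = ?F (- x)"
      by simp
  qed
  ultimately show ?thesis by (auto simp: cinf_fun_def filterlim_at_bot_mirror)
qed

lemma k1_odd: "k1 \<alpha> \<beta> f\<^sub>1 f\<^sub>2 (- x) = - k1 \<alpha> \<beta> f\<^sub>1 f\<^sub>2 x"
  and k2_even: "k2 f\<^sub>1 f\<^sub>2 (- x) = k2 f\<^sub>1 f\<^sub>2 x"
  by (simp_all add: k1_def k2_def odd_part_def even_part_def algebra_simps)

lemma P_well_defined: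
  assumes "\<alpha> \<ge> 0" "\<beta> \<ge> 0" "\<alpha> + \<beta> > 0"
  shows "cinf_fun (P_left \<alpha> \<beta> f\<^sub>1 f\<^sub>2)" "cinf_fun (P_right \<alpha> \<beta> f\<^sub>1 f\<^sub>2)"
proof -
  define s where "s = gam \<alpha> \<beta>"
  have "\<alpha>\<^sup>2 + \<beta>\<^sup>2 > 0" using assms
    by (metis add_cancel_right_left less_irrefl sum_power2_gt_zero_iff)
  then have s: "s > 0" by (simp add: s_def gam_def)
  define k where "k = k1 \<alpha> \<beta> f\<^sub>1 f\<^sub>2"
  define m where "m = k2 f\<^sub>1 f\<^sub>2"
  define c where "c = laplace k s + s / 2 * laplace m s"
  have k: "cinf_fun k" "\<And>x. k (- x) = - k x" and m: "cinf_fun m" "\<And>x. m (- x) = m x"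
    by (simp_all add: cinf_fun_apply k_def m_def k1_odd k2_even)
  have cc: "c_const \<alpha> \<beta> f\<^sub>1 f\<^sub>2 = c"
    by (simp add: c_const_def c_def s_def k_def m_def)
  have neg: "convol (\<lambda>y. (- p) * k y + q * m y) g x = - convol (\<lambda>y. p * k y - q * m y) g x"
    "convol (\<lambda>y. (- p) * k y + (- q) * m y) g x = - convol (\<lambda>y. p * k y + q * m y) g x"
    for p q g x
    by (simp_all add: convol_uminus(1)[symmetric])
  note H = hyp_conv_cinf_fun[OF k m s]
  have "cinf_fun (\<lambda>x. c * (2 * \<alpha> / s) * sinh (s * x) + (- c) * cosh (s * x)
      + convol (\<lambda>y. (- (2 * \<alpha> / s)) * k y + (s / 2) * m y) (\<lambda>y. sinh (s * y)) x
      + convol (\<lambda>y. 1 * k y + (- \<alpha>) * m y) (\<lambda>y. cosh (s * y)) x)"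
    by (rule H) (use s in \<open>simp_all add: c_def field_simps\<close>)
  moreover have "P_left \<alpha> \<beta> f\<^sub>1 f\<^sub>2 = (\<lambda>x. even_part f\<^sub>1 x +
     (c * (2 * \<alpha> / s) * sinh (s * x) + (- c) * cosh (s * x)
      + convol (\<lambda>y. (- (2 * \<alpha> / s)) * k y + (s / 2) * m y) (\<lambda>y. sinh (s * y)) x
      + convol (\<lambda>y. 1 * k y + (- \<alpha>) * m y) (\<lambda>y. cosh (s * y)) x))"
    by (rule ext) (simp only: P_left_def Let_def cc s_def[symmetric] k_def[symmetric]
        m_def[symmetric] neg, simp add: right_diff_distrib distrib_left)
  ultimately show "cinf_fun (P_left \<alpha> \<beta> f\<^sub>1 f\<^sub>2)"
    by (simp only: cinf_fun_add cinf_fun_apply)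
  have "cinf_fun (\<lambda>x. c * (2 * \<beta> / s) * sinh (s * x) + c * cosh (s * x)
      + convol (\<lambda>y. (- (2 * \<beta> / s)) * k y + (- (s / 2)) * m y) (\<lambda>y. sinh (s * y)) x
      + convol (\<lambda>y. (- 1) * k y + (- \<beta>) * m y) (\<lambda>y. cosh (s * y)) x)"
    by (rule H) (use s in \<open>simp_all add: c_def field_simps\<close>)
  moreover have "P_right \<alpha> \<beta> f\<^sub>1 f\<^sub>2 = (\<lambda>x. even_part f\<^sub>2 x +
     (c * (2 * \<beta> / s) * sinh (s * x) + c * cosh (s * x)
      + convol (\<lambda>y. (- (2 * \<beta> / s)) * k y + (- (s / 2)) * m y) (\<lambda>y. sinh (s * y)) x
      + convol (\<lambda>y. (- 1) * k y + (- \<beta>) * m y) (\<lambda>y. cosh (s * y)) x))"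
    by (rule ext) (simp only: P_right_def Let_def cc s_def[symmetric] k_def[symmetric]
        m_def[symmetric] neg, simp add: right_diff_distrib distrib_left)
  ultimately show "cinf_fun (P_right \<alpha> \<beta> f\<^sub>1 f\<^sub>2)"
    by (simp only: cinf_fun_add cinf_fun_apply)
qed

corollary apply_P_op:
  assumes "\<alpha> \<ge> 0" "\<beta> \<ge> 0" "\<alpha> + \<beta> > 0"
  shows "apply_cinf (fst (P_op \<alpha> \<beta> (f\<^sub>1, f\<^sub>2))) = P_left \<alpha> \<beta> f\<^sub>1 f\<^sub>2"
    and "apply_cinf (snd (P_op \<alpha> \<beta> (f\<^sub>1, f\<^sub>2))) = P_right \<alpha> \<beta> f\<^sub>1 f\<^sub>2"
  by (simp_all add: P_op_def apply_Abs_cinf P_well_defined[OF assms])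

corollary apply_E_skew:
  assumes "\<alpha> + \<beta> \<noteq> 0"
  shows "apply_cinf (fst (E_skew \<alpha> \<beta> f)) = E_left \<alpha> \<beta> f"
    and "apply_cinf (snd (E_skew \<alpha> \<beta> f)) = E_right \<alpha> \<beta> f"
  by (simp_all add: E_skew_def apply_Abs_cinf E_skew_well_defined[OF assms])

end

theory Submission
  imports Defs
begin

text \<open>For \<open>s > 0\<close> let \<open>A\<^sub>\<plusminus> h x = s \<integral>\<^sub>0\<^sup>\<infinity> exp (- s u) h (x \<plusminus> u) du\<close>
  (\<open>exp_average (\<plusminus> 1) h s x\<close> below). Completing the convolutions with
  \<open>sinh\<close> and \<open>cosh\<close> to integrals over a half-line produces \<open>A\<^sub>\<plusminus>\<close> and exponentially growing terms;
  the constant \<open>c\<close> cancels the latter exactly, so that \<open>P_left\<close> and \<open>P_right\<close> are linear combinations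
  of \<open>A\<^sub>\<plusminus> k1\<close> and \<open>A\<^sub>\<plusminus> k2\<close> on the whole line. Replacing \<open>(\<alpha>, \<beta>)\<close> by \<open>(n \<alpha>, n \<beta>)\<close> merely turns \<open>s\<close>
  into \<open>n \<gamma>\<close>, and \<open>A\<^sub>\<plusminus> h\<close> tends to \<open>h\<close> uniformly as \<open>s\<close> tends to infinity, because \<open>h\<close> is bounded and
  uniformly continuous.\<close>

section \<open>Uniform continuity and stability under shifts\<close>

lemma cinf_fun_uniformly_continuous:
  assumes "cinf_fun h"
  shows "uniformly_continuous_on UNIV h"
  unfolding uniformly_continuous_on_def
proof (intro allI impI)
  fix e :: real assume e: "e > 0"
  obtain l m where l: "(h \<longlongrightarrow> l) at_top" and m: "(h \<longlongrightarrow> m) at_bot"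
    and c: "continuous_on UNIV h" using assms by (auto simp: cinf_fun_def)
  have "\<forall>\<^sub>F x in at_top. \<bar>h x - l\<bar> < e / 2"
    using tendstoD[OF l, of "e / 2"] e by (simp add: dist_real_def)
  then obtain a where a: "\<And>x. x \<ge> a \<Longrightarrow> \<bar>h x - l\<bar> < e / 2"
    by (auto simp: eventually_at_top_linorder)
  have "\<forall>\<^sub>F x in at_bot. \<bar>h x - m\<bar> < e / 2"
    using tendstoD[OF m, of "e / 2"] e by (simp add: dist_real_def)
  then obtain b where b: "\<And>x. x \<le> b \<Longrightarrow> \<bar>h x - m\<bar> < e / 2"
    by (auto simp: eventually_at_bot_linorder)
  \<comment> \<open>The margin 1 goes with \<open>min d 1\<close> below: two points less than 1
    apart lie both in this interval or both in one of the tails \<open>x \<ge> a\<close>,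
    \<open>x \<le> b\<close>.\<close>
  have "uniformly_continuous_on {b - 1..a + 1} h"
    by (intro compact_uniformly_continuous continuous_on_subset[OF c]) auto
  then obtain d where d: "d > 0"
    "\<And>x y. x \<in> {b - 1..a + 1} \<Longrightarrow> y \<in> {b - 1..a + 1} \<Longrightarrow> dist y x < d \<Longrightarrow> dist (h y) (h x) < e"
    using e unfolding uniformly_continuous_on_def by metis
  show "\<exists>d>0. \<forall>x\<in>UNIV. \<forall>x'\<in>UNIV. dist x' x < d \<longrightarrow> dist (h x') (h x) < e"
  proof (intro exI[of _ "min d 1"] conjI ballI impI)
    fix x y :: real assume xy: "dist y x < min d 1"
    consider "x \<in> {b - 1..a + 1}" "y \<in> {b - 1..a + 1}" | "x \<ge> a" "y \<ge> a" | "x \<le> b" "y \<le> b"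
      using xy unfolding dist_real_def by force
    then show "dist (h y) (h x) < e"
    proof cases
      case 1 then show ?thesis using d xy by simp
    next
      case 2 then show ?thesis using a[of x] a[of y] unfolding dist_real_def by linarith
    next
      case 3 then show ?thesis using b[of x] b[of y] unfolding dist_real_def by linarith
    qed
  qed (use d in simp)
qed

lemma cinf_fun_shift:
  assumes h: "cinf_fun h" and "\<sigma> = 1 \<or> \<sigma> = -1"
  shows "cinf_fun (\<lambda>u. h (x + \<sigma> * u))"
proof -
  have *: "cinf_fun (\<lambda>u. h (x + u))" if h: "cinf_fun h" for h x
  proof -
    obtain l m where lm: "(h \<longlongrightarrow> l) at_top" "(h \<longlongrightarrow> m) at_bot" and c: "continuous_on UNIV h"
      using h by (auto simp: cinf_fun_def)
    have "continuous_on UNIV (\<lambda>u. h (x + u))"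
      by (intro continuous_on_compose2[OF c] continuous_intros) auto
    moreover have "((\<lambda>u. h (x + u)) \<longlongrightarrow> l) at_top"
      by (intro filterlim_compose[OF lm(1)] filterlim_tendsto_add_at_top[OF tendsto_const] filterlim_ident)
    moreover have "((\<lambda>u. h (x + u)) \<longlongrightarrow> m) at_bot"
    proof (rule filterlim_compose[OF lm(2)], unfold filterlim_at_bot, intro allI)
      fix Z show "\<forall>\<^sub>F u in at_bot. x + u \<le> Z"
        using eventually_le_at_bot[of "Z - x"] by eventually_elim simp
    qed
    ultimately show ?thesis by (auto simp: cinf_fun_def)
  qed
  show ?thesis using assms *[OF h, of x] cinf_fun_reflect[OF *[OF h, of x]] by auto
qed

section \<open>Exponential averages and their uniform convergence\<close>

text \<open>For \<open>s > 0\<close> this is the mean of \<open>h (x + \<sigma> * U)\<close> with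
  \<open>U\<close> exponentially distributed with rate \<open>s\<close>. The parameter
  \<open>s\<close> precedes \<open>x\<close> so that \<open>exp_average \<sigma> h\<close> is a
  family of functions to which \<open>uniform_limit\<close> applies.\<close>

definition exp_average :: "real \<Rightarrow> (real \<Rightarrow> real) \<Rightarrow> real \<Rightarrow> real \<Rightarrow> real"
  where "exp_average \<sigma> h s x = s * laplace (\<lambda>u. h (x + \<sigma> * u)) s"

text \<open>The density \<open>s * exp (- s * u)\<close> on the half-line has mass 1 and mean
  \<open>1 / s\<close>, so an affine bound \<open>e + C * u\<close> on the deviation from
  \<open>g 0\<close> averages to \<open>e + C / s\<close>. The integrals are compared through
  antiderivatives.\<close>

lemma laplace_approx:
  assumes g: "cinf_fun g" and s: "s > 0"
    and bound: "\<And>u. u \<ge> 0 \<Longrightarrow> \<bar>g u - g 0\<bar> \<le> e + C * u" and eC: "e \<ge> 0" "C \<ge> 0"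
  shows "\<bar>s * laplace g s - g 0\<bar> \<le> e + C / s"
proof -
  obtain J where J: "\<And>x. (J has_real_derivative g x * exp (- s * x)) (at x)" "J 0 = 0"
    using ex_antiderivative[of g "- s"] g by (auto simp: cinf_fun_def)
  \<comment> \<open>\<open>F\<close> and \<open>G\<close> vanish at 0 and are antiderivatives of
    \<open>(g u - g 0) * exp (- s * u)\<close> and \<open>(e + C * u) * exp (- s * u)\<close>; the
    second summand of \<open>G\<close> comes from integration by parts.\<close>
  define F where "F u = J u - g 0 * (1 - exp (- s * u)) / s" for u
  define G where "G u = e * (1 - exp (- s * u)) / s + C * (1 - (1 + s * u) * exp (- s * u)) / s\<^sup>2" for u
  have F: "(F has_real_derivative (g u - g 0) * exp (- s * u)) (at u)" for u
    unfolding F_def using s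
    by (auto intro!: derivative_eq_intros J simp: field_simps power2_eq_square)
  have G: "(G has_real_derivative (e + C * u) * exp (- s * u)) (at u)" for u
    unfolding G_def using s
    by (auto intro!: derivative_eq_intros simp: field_simps power2_eq_square)
  have F0: "F 0 = 0" "G 0 = 0" by (simp_all add: F_def G_def J)
  have FG: "\<bar>F u\<bar> \<le> G u" if "u \<ge> 0" for u
  proof -
    \<comment> \<open>Both \<open>G - F\<close> and \<open>G + F\<close> start at 0 and have
      nonnegative derivative by \<open>bound\<close>.\<close>
    have "(\<lambda>u. G u - F u) 0 \<le> (\<lambda>u. G u - F u) u"
    proof (rule DERIV_nonneg_imp_nondecreasing[OF that], intro exI conjI)
      fix x :: real assume "0 \<le> x"
      show "((\<lambda>u. G u - F u) has_real_derivative
          (e + C * x) * exp (- s * x) - (g x - g 0) * exp (- s * x)) (at x)"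
        by (intro DERIV_diff F G)
      show "0 \<le> (e + C * x) * exp (- s * x) - (g x - g 0) * exp (- s * x)"
        using bound[OF \<open>0 \<le> x\<close>] unfolding left_diff_distrib[symmetric] by simp
    qed
    moreover have "(\<lambda>u. G u + F u) 0 \<le> (\<lambda>u. G u + F u) u"
    proof (rule DERIV_nonneg_imp_nondecreasing[OF that], intro exI conjI)
      fix x :: real assume "0 \<le> x"
      show "((\<lambda>u. G u + F u) has_real_derivative
          (e + C * x) * exp (- s * x) + (g x - g 0) * exp (- s * x)) (at x)"
        by (intro DERIV_add F G)
      show "0 \<le> (e + C * x) * exp (- s * x) + (g x - g 0) * exp (- s * x)"
        using bound[OF \<open>0 \<le> x\<close>] unfolding distrib_right[symmetric] by simp
    qed
    ultimately show ?thesis using F0 by simp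
  qed
  have G_le: "G u \<le> e / s + C / s\<^sup>2" if "u \<ge> 0" for u
    unfolding G_def using that s eC
    by (intro add_mono divide_right_mono mult_left_le) auto
  have "(F \<longlongrightarrow> laplace g s - g 0 * (1 - 0) / s) at_top"
    unfolding F_def by (intro tendsto_intros laplace_limit[OF g s J] exp_decay s) (use s in auto)
  then have "((\<lambda>u. \<bar>F u\<bar>) \<longlongrightarrow> \<bar>laplace g s - g 0 / s\<bar>) at_top"
    by (intro tendsto_rabs) simp
  then have "\<bar>laplace g s - g 0 / s\<bar> \<le> e / s + C / s\<^sup>2"
  proof (rule tendsto_upperbound)
    show "\<forall>\<^sub>F u in at_top. \<bar>F u\<bar> \<le> e / s + C / s\<^sup>2"
      using eventually_ge_at_top[of 0] by eventually_elim (use FG G_le in force)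
  qed simp
  then have "s * \<bar>laplace g s - g 0 / s\<bar> \<le> s * (e / s + C / s\<^sup>2)"
    using s by (intro mult_left_mono) auto
  moreover have "s * \<bar>laplace g s - g 0 / s\<bar> = \<bar>s * (laplace g s - g 0 / s)\<bar>"
    using s by (simp add: abs_mult)
  moreover have "s * (laplace g s - g 0 / s) = s * laplace g s - g 0"
    "s * (e / s + C / s\<^sup>2) = e + C / s"
    using s by (simp_all add: field_simps power2_eq_square)
  ultimately show ?thesis by simp
qed

text \<open>One affine bound on \<open>\<bar>h (x + \<sigma> * u) - h x\<bar>\<close>, the same for
  all \<open>x\<close>, makes the estimate of \<open>laplace_approx\<close> uniform.\<close>

lemma uniform_limit_exp_average:
  assumes h: "cinf_fun h" and \<sigma>: "\<sigma> = 1 \<or> \<sigma> = -1"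
  shows "uniform_limit UNIV (exp_average \<sigma> h) h at_top"
proof (rule uniform_limitI)
  fix e :: real assume e: "e > 0"
  obtain B where B: "\<And>x. \<bar>h x\<bar> \<le> B" using cinf_bounded[OF h] by blast
  have B0: "B \<ge> 0" using B[of 0] by simp
  obtain d where d: "d > 0" "\<And>x y. \<bar>y - x\<bar> < d \<Longrightarrow> \<bar>h y - h x\<bar> < e / 2"
    using cinf_fun_uniformly_continuous[OF h] e
    unfolding uniformly_continuous_on_def dist_real_def by (metis UNIV_I half_gt_zero)
  \<comment> \<open>With this slope \<open>C * u \<ge> 2 * B\<close> once \<open>u \<ge> d\<close>:
    boundedness of \<open>h\<close> takes over where uniform continuity stops.\<close>
  define C where "C = 2 * B / d"
  have C0: "C \<ge> 0" using B0 d by (simp add: C_def)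
  have bound: "\<bar>h (x + \<sigma> * u) - h x\<bar> \<le> e / 2 + C * u" if u: "u \<ge> 0" for x u
  proof (cases "u < d")
    case True
    then have "\<bar>(x + \<sigma> * u) - x\<bar> < d" using \<sigma> u by auto
    then show ?thesis using d(2) mult_nonneg_nonneg[OF C0 u] by fastforce
  next
    case False
    then have "2 * B \<le> C * u"
      using B0 d mult_left_mono[of d u "2 * B"] by (simp add: C_def field_simps)
    then show ?thesis using B[of "x + \<sigma> * u"] B[of x] e by linarith
  qed
  show "\<forall>\<^sub>F s in at_top. \<forall>x\<in>UNIV. dist (exp_average \<sigma> h s x) (h x) < e"
    using eventually_gt_at_top[of "2 * C / e"]
  proof eventually_elim
    case (elim s)
    have s: "s > 0" using elim C0 e by (smt (verit) divide_nonneg_pos)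
    have Cs: "C / s < e / 2" using elim s e by (simp add: field_simps)
    show ?case
    proof
      fix x
      have "\<bar>s * laplace (\<lambda>u. h (x + \<sigma> * u)) s - h (x + \<sigma> * 0)\<bar> \<le> e / 2 + C / s"
        by (rule laplace_approx[OF cinf_fun_shift[OF h \<sigma>] s]) (use bound e C0 in simp_all)
      then show "dist (exp_average \<sigma> h s x) (h x) < e"
        using Cs unfolding exp_average_def dist_real_def mult_zero_right add_0_right by linarith
    qed
  qed
qed

section \<open>Convolutions with sinh and cosh in terms of exponential averages\<close>

text \<open>The integral over \<open>[0, x]\<close> is split into half-line integrals: from 0 to
  infinity minus from \<open>x\<close> to infinity for \<open>K\<close>, and from minus infinity to
  \<open>x\<close> minus from minus infinity to 0 for \<open>L\<close>. Shifting the variable turns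
  the integrals ending at \<open>x\<close> into exponential averages.\<close>

lemma exp_antiderivative_laplace:
  assumes h: "cinf_fun h" and s: "s > 0"
  shows "\<And>K. (\<And>x. (K has_real_derivative h x * exp (- s * x)) (at x)) \<Longrightarrow> K 0 = 0 \<Longrightarrow>
      exp (s * x) * K x = exp (s * x) * laplace h s - exp_average 1 h s x / s"
    and "\<And>L. (\<And>x. (L has_real_derivative h x * exp (s * x)) (at x)) \<Longrightarrow> L 0 = 0 \<Longrightarrow>
      exp (- s * x) * L x = exp_average (-1) h s x / s - exp (- s * x) * laplace (\<lambda>u. h (- u)) s"
proof -
  fix K assume K: "\<And>x. (K has_real_derivative h x * exp (- s * x)) (at x)" "K 0 = 0"
  \<comment> \<open>\<open>J\<close> is the antiderivative of
    \<open>h (x + u) * exp (- s * u)\<close> vanishing at 0. Its limit at infinity is computed by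
    \<open>laplace_limit\<close> and again from the limit of \<open>K\<close>; uniqueness of limits
    gives the identity.\<close>
  define J where "J u = exp (s * x) * (K (x + u) - K x)" for u
  have "(J has_real_derivative exp (s * x) * (h (x + u) * exp (- s * (x + u)))) (at u)" for u
    unfolding J_def by (rule derivative_eq_intros DERIV_chain2[OF K(1)] refl | simp)+
  moreover have "exp (s * x) * (h (x + u) * exp (- s * (x + u))) = h (x + 1 * u) * exp (- s * u)" for u
    by (simp add: mult.left_commute exp_add[symmetric] algebra_simps)
  ultimately have J: "\<And>u. (J has_real_derivative h (x + 1 * u) * exp (- s * u)) (at u)" by metis
  have "(J \<longlongrightarrow> laplace (\<lambda>u. h (x + 1 * u)) s) at_top"
    by (rule laplace_limit[OF cinf_fun_shift[OF h] s J]) (simp_all add: J_def)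
  moreover have "((\<lambda>u. K (x + u)) \<longlongrightarrow> laplace h s) at_top"
    by (intro filterlim_compose[OF laplace_limit[OF h s K]]
        filterlim_tendsto_add_at_top[OF tendsto_const] filterlim_ident)
  then have "(J \<longlongrightarrow> exp (s * x) * (laplace h s - K x)) at_top"
    unfolding J_def by (intro tendsto_intros)
  ultimately have "laplace (\<lambda>u. h (x + 1 * u)) s = exp (s * x) * (laplace h s - K x)"
    by (rule tendsto_unique[rotated]) simp
  then show "exp (s * x) * K x = exp (s * x) * laplace h s - exp_average 1 h s x / s"
    using s by (simp add: exp_average_def) (simp add: right_diff_distrib)
next
  fix L assume L: "\<And>x. (L has_real_derivative h x * exp (s * x)) (at x)" "L 0 = 0"
  define J where "J u = exp (- s * x) * (L x - L (x - u))" for u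
  have "(J has_real_derivative exp (- s * x) * (h (x - u) * exp (s * (x - u)))) (at u)" for u
    unfolding J_def by (rule derivative_eq_intros DERIV_chain2[OF L(1)] refl | simp)+
  moreover have "exp (- s * x) * (h (x - u) * exp (s * (x - u))) = h (x + (-1) * u) * exp (- s * u)" for u
    by (simp add: mult.left_commute exp_add[symmetric] algebra_simps)
  ultimately have J: "\<And>u. (J has_real_derivative h (x + (-1) * u) * exp (- s * u)) (at u)" by metis
  have "(J \<longlongrightarrow> laplace (\<lambda>u. h (x + (-1) * u)) s) at_top"
    by (rule laplace_limit[OF cinf_fun_shift[OF h] s J]) (simp_all add: J_def)
  moreover
  \<comment> \<open>Reflection reduces the limit of \<open>L\<close> at minus infinity to
    \<open>laplace_limit\<close>.\<close>
  have "((\<lambda>v. - L (- v)) has_real_derivative h (- v) * exp (- s * v)) (at v)" for v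
    by (rule derivative_eq_intros DERIV_chain2[OF L(1)] refl | simp)+
  then have lim: "((\<lambda>v. - L (- v)) \<longlongrightarrow> laplace (\<lambda>u. h (- u)) s) at_top"
    by (rule laplace_limit[OF cinf_fun_reflect[OF h] s]) (simp add: L)
  have "((\<lambda>u. - L (- (- x + u))) \<longlongrightarrow> laplace (\<lambda>u. h (- u)) s) at_top"
    by (rule filterlim_compose[OF lim])
      (intro filterlim_tendsto_add_at_top[OF tendsto_const] filterlim_ident)
  then have "((\<lambda>u. exp (- s * x) * (L x + (- L (- (- x + u))))) \<longlongrightarrow>
      exp (- s * x) * (L x + laplace (\<lambda>u. h (- u)) s)) at_top"
    by (intro tendsto_intros)
  then have "(J \<longlongrightarrow> exp (- s * x) * (L x + laplace (\<lambda>u. h (- u)) s)) at_top"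
    by (simp add: J_def[abs_def])
  ultimately have "laplace (\<lambda>u. h (x + (-1) * u)) s = exp (- s * x) * (L x + laplace (\<lambda>u. h (- u)) s)"
    by (rule tendsto_unique[rotated]) simp
  then show "exp (- s * x) * L x = exp_average (-1) h s x / s - exp (- s * x) * laplace (\<lambda>u. h (- u)) s"
    using s by (simp add: exp_average_def) (simp add: distrib_left)
qed

text \<open>Since the averages of a bounded function are bounded, all possible growth in
  \<open>x\<close> is isolated in the two exponentials weighted by Laplace transforms.\<close>

lemma convol_sinh_cosh_laplace:
  assumes h: "cinf_fun h" and s: "s > 0"
  shows "convol h (\<lambda>y. sinh (s * y)) x =
      (exp (s * x) * laplace h s + exp (- s * x) * laplace (\<lambda>u. h (- u)) s) / 2
      - (exp_average 1 h s x + exp_average (-1) h s x) / (2 * s)" (is ?S)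
    and "convol h (\<lambda>y. cosh (s * y)) x =
      (exp (s * x) * laplace h s - exp (- s * x) * laplace (\<lambda>u. h (- u)) s) / 2
      - (exp_average 1 h s x - exp_average (-1) h s x) / (2 * s)" (is ?C)
proof -
  have c: "continuous_on UNIV h" using h by (simp add: cinf_fun_def)
  obtain K where K: "\<And>x. (K has_real_derivative h x * exp (- s * x)) (at x)" "K 0 = 0"
    using ex_antiderivative[OF c, of "- s"] by blast
  obtain L where L: "\<And>x. (L has_real_derivative h x * exp (s * x)) (at x)" "L 0 = 0"
    using ex_antiderivative[OF c, of "s"] by blast
  show ?S ?C
    unfolding convol_sinh_cosh[OF c K L] exp_antiderivative_laplace(1)[OF h s K]
      exp_antiderivative_laplace(2)[OF h s L] using s by (simp_all add: field_simps)
qed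

lemma exp_average_comb:
  assumes "cinf_fun h" "cinf_fun k" "s > 0" "\<sigma> = 1 \<or> \<sigma> = -1"
  shows "exp_average \<sigma> (\<lambda>y. p * h y + q * k y) s x
    = p * exp_average \<sigma> h s x + q * exp_average \<sigma> k s x"
  using laplace_comb[OF cinf_fun_shift[OF assms(1,4)] cinf_fun_shift[OF assms(2,4)] assms(3), of p x q x]
  by (simp add: exp_average_def algebra_simps)

text \<open>Reflection negates the Laplace transform of the odd \<open>k\<close> and preserves that
  of the even \<open>m\<close>, so the exponentials recombine into \<open>sinh\<close> or
  \<open>cosh\<close>, the form in which they meet the terms with \<open>c_const\<close>.\<close>

lemma convol_odd_even:
  assumes k: "cinf_fun k" "\<And>x. k (- x) = - k x" and m: "cinf_fun m" "\<And>x. m (- x) = m x"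
    and s: "s > 0"
  shows "convol (\<lambda>y. p * k y + q * m y) (\<lambda>y. sinh (s * y)) x =
      p * (laplace k s * sinh (s * x) - (exp_average 1 k s x + exp_average (-1) k s x) / (2 * s))
    + q * (laplace m s * cosh (s * x) - (exp_average 1 m s x + exp_average (-1) m s x) / (2 * s))" (is ?S)
    and "convol (\<lambda>y. p * k y + q * m y) (\<lambda>y. cosh (s * y)) x =
      p * (laplace k s * cosh (s * x) - (exp_average 1 k s x - exp_average (-1) k s x) / (2 * s))
    + q * (laplace m s * sinh (s * x) - (exp_average 1 m s x - exp_average (-1) m s x) / (2 * s))" (is ?C)
proof -
  have cf: "cinf_fun (\<lambda>y. p * k y + q * m y)"
    by (intro cinf_fun_add cinf_fun_scale k m)
  have lap: "laplace (\<lambda>y. p * k y + q * m y) s = p * laplace k s + q * laplace m s"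
    by (rule laplace_comb[OF k(1) m(1) s])
  have "laplace (\<lambda>y. (- p) * k y + q * m y) s = (- p) * laplace k s + q * laplace m s"
    by (rule laplace_comb[OF k(1) m(1) s])
  then have lap': "laplace (\<lambda>u. p * k (- u) + q * m (- u)) s = - p * laplace k s + q * laplace m s"
    by (simp add: k m)
  have av: "exp_average \<sigma> (\<lambda>y. p * k y + q * m y) s x
      = p * exp_average \<sigma> k s x + q * exp_average \<sigma> m s x" if "\<sigma> = 1 \<or> \<sigma> = -1" for \<sigma>
    by (rule exp_average_comb[OF k(1) m(1) s that])
  have av1: "exp_average 1 (\<lambda>y. p * k y + q * m y) s x
      = p * exp_average 1 k s x + q * exp_average 1 m s x"
    and av2: "exp_average (-1) (\<lambda>y. p * k y + q * m y) s x
      = p * exp_average (-1) k s x + q * exp_average (-1) m s x" by (rule av; simp)+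
  note hyp = sinh_field_def[of "s * x"] cosh_field_def[of "s * x"]
  show ?S ?C
    unfolding convol_sinh_cosh_laplace[OF cf s] lap lap' av1 av2 hyp
    using s by (simp_all add: field_simps)
qed

section \<open>The operators as combinations of averages, and their scaling\<close>

lemma gam_pos:
  assumes "\<alpha> + \<beta> > 0" shows "gam \<alpha> \<beta> > 0"
proof -
  have "\<alpha>\<^sup>2 + \<beta>\<^sup>2 > 0" using assms
    by (metis add_cancel_right_left less_irrefl sum_power2_gt_zero_iff)
  then show ?thesis by (simp add: gam_def)
qed

text \<open>Multiplying out \<open>c_const\<close> gives four hyperbolic terms, and each of them is
  cancelled by one from the convolutions.\<close>

lemma P_exp_average:
  fixes f\<^sub>1 f\<^sub>2 :: cinf
  assumes "\<alpha> + \<beta> > 0"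
  defines "s \<equiv> gam \<alpha> \<beta>" and "k \<equiv> k1 \<alpha> \<beta> f\<^sub>1 f\<^sub>2" and "m \<equiv> k2 f\<^sub>1 f\<^sub>2"
  shows "P_left \<alpha> \<beta> f\<^sub>1 f\<^sub>2 x = even_part f\<^sub>1 x
      + \<alpha> / s\<^sup>2 * (exp_average 1 k s x + exp_average (-1) k s x)
      + - (1/4) * (exp_average 1 m s x + exp_average (-1) m s x)
      + - (1 / (2 * s)) * (exp_average 1 k s x - exp_average (-1) k s x)
      + \<alpha> / (2 * s) * (exp_average 1 m s x - exp_average (-1) m s x)" (is ?L)
    and "P_right \<alpha> \<beta> f\<^sub>1 f\<^sub>2 x = even_part f\<^sub>2 x
      + \<beta> / s\<^sup>2 * (exp_average 1 k s x + exp_average (-1) k s x)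
      + 1/4 * (exp_average 1 m s x + exp_average (-1) m s x)
      + 1 / (2 * s) * (exp_average 1 k s x - exp_average (-1) k s x)
      + \<beta> / (2 * s) * (exp_average 1 m s x - exp_average (-1) m s x)" (is ?R)
proof -
  have s: "s > 0" using gam_pos assms by simp
  have k: "cinf_fun k" "\<And>x. k (- x) = - k x" and m: "cinf_fun m" "\<And>x. m (- x) = m x"
    by (simp_all add: cinf_fun_apply k_def m_def k1_odd k2_even)
  have cc: "c_const \<alpha> \<beta> f\<^sub>1 f\<^sub>2 = laplace k s + s / 2 * laplace m s"
    by (simp add: c_const_def s_def k_def m_def)
  note conv = convol_odd_even[OF k m s]
  \<comment> \<open>Explicit coefficients bring the integrands to the shape required by
    \<open>conv\<close>.\<close>
  have d: "(\<lambda>y. p * k y - q * m y) = (\<lambda>y. p * k y + (- q) * m y)"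
    "(\<lambda>y. k y - q * m y) = (\<lambda>y. 1 * k y + (- q) * m y)"
    "(\<lambda>y. k y + q * m y) = (\<lambda>y. 1 * k y + q * m y)" for p q
    by auto
  \<comment> \<open>With \<open>t\<close> for \<open>1 / s\<close> the identities become polynomial;
    the relation \<open>s * t = 1\<close> then enters only through the multiple of
    \<open>s * t - 1\<close> split off below.\<close>
  define t where "t = 1 / s"
  have st: "s * t = 1" using s by (simp add: t_def)
  have inv: "2 * y / s = 2 * y * t" "y / (2 * s) = y * t / 2" "y / s\<^sup>2 = y * t * t" for y
    by (simp_all add: t_def power2_eq_square)
  \<comment> \<open>\<open>K\<close>, \<open>M\<close> stand for the Laplace transforms of
    \<open>k\<close>, \<open>m\<close>; \<open>P\<close>, \<open>Q\<close> for the sums and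
    \<open>R\<close>, \<open>S\<close> for the differences of their forward and backward
    averages.\<close>
  have left: "e + (K + s / 2 * M) * (2 * a / s * sh - ch)
      - (2 * a / s * (K * sh - P / (2 * s)) + - (s / 2) * (M * ch - Q / (2 * s)))
      + (1 * (K * ch - R / (2 * s)) + - a * (M * sh - S / (2 * s)))
    = e + a / s\<^sup>2 * P + - (1/4) * Q + - (1 / (2 * s)) * R + a / (2 * s) * S" (is "?l = ?r")
    for e K M a sh ch P Q R S
  proof -
    have "?l = ?r + (s * t - 1) * (a * M * sh - Q / 4)"
      unfolding inv by (simp add: field_simps)
    then show ?thesis by (simp add: st)
  qed
  have right: "e + (K + s / 2 * M) * (2 * a / s * sh + ch)
      - (2 * a / s * (K * sh - P / (2 * s)) + s / 2 * (M * ch - Q / (2 * s)))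
      - (1 * (K * ch - R / (2 * s)) + a * (M * sh - S / (2 * s)))
    = e + a / s\<^sup>2 * P + 1/4 * Q + 1 / (2 * s) * R + a / (2 * s) * S" (is "?l = ?r")
    for e K M a sh ch P Q R S
  proof -
    have "?l = ?r + (s * t - 1) * (a * M * sh + Q / 4)"
      unfolding inv by (simp add: field_simps)
    then show ?thesis by (simp add: st)
  qed
  show ?L
    unfolding P_left_def Let_def cc s_def[symmetric] k_def[symmetric] m_def[symmetric] d conv
    by (rule left)
  show ?R
    unfolding P_right_def Let_def cc s_def[symmetric] k_def[symmetric] m_def[symmetric] d conv
    by (rule right)
qed

lemma gam_scale:
  assumes "r \<ge> 0"
  shows "gam (r * \<alpha>) (r * \<beta>) = r * gam \<alpha> \<beta>"
proof -
  have "2 * ((r * \<alpha>)\<^sup>2 + (r * \<beta>)\<^sup>2) = r\<^sup>2 * (2 * (\<alpha>\<^sup>2 + \<beta>\<^sup>2))"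
    by (simp add: algebra_simps)
  then show ?thesis using assms by (simp only: gam_def real_sqrt_mult[of "r\<^sup>2"]) simp
qed

text \<open>Both \<open>gam\<close> and \<open>k1\<close> are homogeneous of degree one in the
  parameters and \<open>k2\<close> is independent of them, so \<open>r\<close> cancels from all
  coefficients and survives only in the rate \<open>r * \<gamma>\<close>.\<close>

lemma P_exp_average_scaled:
  fixes f\<^sub>1 f\<^sub>2 :: cinf
  assumes r: "r > 0" and pos: "\<alpha> + \<beta> > 0"
  defines "\<gamma> \<equiv> gam \<alpha> \<beta>" and "k \<equiv> k1 \<alpha> \<beta> f\<^sub>1 f\<^sub>2" and "m \<equiv> k2 f\<^sub>1 f\<^sub>2"
  shows "P_left (r * \<alpha>) (r * \<beta>) f\<^sub>1 f\<^sub>2 x = even_part f\<^sub>1 x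
      + \<alpha> / \<gamma>\<^sup>2 * (exp_average 1 k (r * \<gamma>) x + exp_average (-1) k (r * \<gamma>) x)
      + - (1/4) * (exp_average 1 m (r * \<gamma>) x + exp_average (-1) m (r * \<gamma>) x)
      + - (1 / (2 * \<gamma>)) * (exp_average 1 k (r * \<gamma>) x - exp_average (-1) k (r * \<gamma>) x)
      + \<alpha> / (2 * \<gamma>) * (exp_average 1 m (r * \<gamma>) x - exp_average (-1) m (r * \<gamma>) x)" (is ?L)
    and "P_right (r * \<alpha>) (r * \<beta>) f\<^sub>1 f\<^sub>2 x = even_part f\<^sub>2 x
      + \<beta> / \<gamma>\<^sup>2 * (exp_average 1 k (r * \<gamma>) x + exp_average (-1) k (r * \<gamma>) x)
      + 1/4 * (exp_average 1 m (r * \<gamma>) x + exp_average (-1) m (r * \<gamma>) x)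
      + 1 / (2 * \<gamma>) * (exp_average 1 k (r * \<gamma>) x - exp_average (-1) k (r * \<gamma>) x)
      + \<beta> / (2 * \<gamma>) * (exp_average 1 m (r * \<gamma>) x - exp_average (-1) m (r * \<gamma>) x)" (is ?R)
proof -
  have \<gamma>: "\<gamma> > 0" using gam_pos[OF pos] by (simp add: \<gamma>_def)
  have pos': "r * \<alpha> + r * \<beta> > 0" using r pos by (simp flip: distrib_left)
  have g: "gam (r * \<alpha>) (r * \<beta>) = r * \<gamma>" using r by (simp add: gam_scale \<gamma>_def)
  \<comment> \<open>The summand \<open>0 * k y\<close> makes the multiple a combination to which
    \<open>exp_average_comb\<close> applies.\<close>
  have k: "apply_cinf (k1 (r * \<alpha>) (r * \<beta>) f\<^sub>1 f\<^sub>2) = (\<lambda>y. r * k y + 0 * k y)"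
    by (auto simp: k1_def k_def algebra_simps)
  have av: "exp_average 1 (\<lambda>y. r * k y + 0 * k y) (r * \<gamma>) x = r * exp_average 1 k (r * \<gamma>) x"
    "exp_average (-1) (\<lambda>y. r * k y + 0 * k y) (r * \<gamma>) x = r * exp_average (-1) k (r * \<gamma>) x"
    by (subst exp_average_comb[OF cinf_fun_apply cinf_fun_apply]; use r \<gamma> in simp)+
  have coef: "r * a / (r * \<gamma>)\<^sup>2 * (r * u + r * v) = a / \<gamma>\<^sup>2 * (u + v)"
    "1 / (2 * (r * \<gamma>)) * (r * u - r * v) = 1 / (2 * \<gamma>) * (u - v)"
    "r * a / (2 * (r * \<gamma>)) * u = a / (2 * \<gamma>) * u" for a u v
    unfolding distrib_left[symmetric] right_diff_distrib[symmetric]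
    using r \<gamma> by (simp_all add: power2_eq_square)
  have coef': "- (1 / (2 * (r * \<gamma>))) * (r * u - r * v) = - (1 / (2 * \<gamma>)) * (u - v)" for u v
    using coef(2)[of u v] by simp
  show ?L ?R
    unfolding P_exp_average[OF pos'] g k m_def[symmetric] av coef coef' by (rule refl)+
qed

section \<open>Passage to the limit\<close>

lemma cinf_tendsto_iff_uniform_limit:
  "(X \<longlongrightarrow> L) F \<longleftrightarrow> uniform_limit UNIV (\<lambda>n. apply_cinf (X n)) (apply_cinf L) F"
proof
  assume X: "(X \<longlongrightarrow> L) F"
  show "uniform_limit UNIV (\<lambda>n. apply_cinf (X n)) (apply_cinf L) F"
  proof (rule uniform_limitI)
    fix e :: real assume "e > 0"
    from tendstoD[OF X this]
    show "\<forall>\<^sub>F n in F. \<forall>x\<in>UNIV. dist (apply_cinf (X n) x) (apply_cinf L x) < e"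
    proof eventually_elim
      case (elim n)
      show ?case
      proof
        fix x
        show "dist (apply_cinf (X n) x) (apply_cinf L x) < e"
          using elim cinf_abs_le_norm[of "X n - L" x] by (simp add: dist_cinf_def dist_real_def)
      qed
    qed
  qed
next
  assume X: "uniform_limit UNIV (\<lambda>n. apply_cinf (X n)) (apply_cinf L) F"
  show "(X \<longlongrightarrow> L) F"
  proof (rule tendstoI)
    fix e :: real assume e: "e > 0"
    \<comment> \<open>Pointwise bounds pass to the supremum only as \<open>\<le>\<close>; halving
      \<open>e\<close> restores strictness.\<close>
    then have "e / 2 > 0" by simp
    from uniform_limitD[OF X this] show "\<forall>\<^sub>F n in F. dist (X n) L < e"
    proof eventually_elim
      case (elim n)
      then have "norm (X n - L) \<le> e / 2"
        by (intro cinf_norm_le) (auto simp: dist_real_def intro: less_imp_le)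
      then show ?case using e by (simp add: dist_cinf_def)
    qed
  qed
qed

text \<open>Forward and backward averages have the same uniform limit: their sums tend to twice the
  function, which yields the coefficients of \<open>P_skew\<close>, and their differences
  vanish.\<close>

lemma P_op_tendsto_P_skew:
  fixes f\<^sub>1 f\<^sub>2 :: cinf
  assumes nonneg: "\<alpha> \<ge> 0" "\<beta> \<ge> 0" and pos: "\<alpha> + \<beta> > 0"
  shows "(\<lambda>n. P_op (real n * \<alpha>) (real n * \<beta>) (f\<^sub>1, f\<^sub>2)) \<longlonglongrightarrow> P_skew \<alpha> \<beta> (f\<^sub>1, f\<^sub>2)"
proof -
  define \<gamma> where "\<gamma> = gam \<alpha> \<beta>"
  define k where "k = k1 \<alpha> \<beta> f\<^sub>1 f\<^sub>2"
  define m where "m = k2 f\<^sub>1 f\<^sub>2"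
  have \<gamma>: "\<gamma> > 0" using gam_pos[OF pos] by (simp add: \<gamma>_def)
  have s_lim: "filterlim (\<lambda>n. real n * \<gamma>) at_top sequentially"
    using \<gamma> by (intro filterlim_at_top_mult_tendsto_pos[OF tendsto_const] filterlim_real_sequentially)
  have av: "uniform_limit UNIV (\<lambda>n. exp_average \<sigma> (apply_cinf h) (real n * \<gamma>)) (apply_cinf h) sequentially"
    if "\<sigma> = 1 \<or> \<sigma> = -1" for \<sigma> h
    by (rule filterlim_compose[OF uniform_limit_exp_average[OF cinf_fun_apply that] s_lim])
  have av1: "uniform_limit UNIV (\<lambda>n. exp_average 1 (apply_cinf h) (real n * \<gamma>)) (apply_cinf h) sequentially"
    and av2: "uniform_limit UNIV (\<lambda>n. exp_average (-1) (apply_cinf h) (real n * \<gamma>)) (apply_cinf h) sequentially"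
    for h by (rule av; simp)+
  \<comment> \<open>For \<open>n = 0\<close> both parameters are 0 and \<open>apply_P_op\<close>
    says nothing; the limit ignores this term.\<close>
  have posn: "\<forall>\<^sub>F n in sequentially. real n > 0"
    using eventually_gt_at_top[of "0::nat"] by eventually_elim simp
  have eq: "\<forall>\<^sub>F n in sequentially.
      apply_cinf (fst (P_op (real n * \<alpha>) (real n * \<beta>) (f\<^sub>1, f\<^sub>2))) = P_left (real n * \<alpha>) (real n * \<beta>) f\<^sub>1 f\<^sub>2 \<and>
      apply_cinf (snd (P_op (real n * \<alpha>) (real n * \<beta>) (f\<^sub>1, f\<^sub>2))) = P_right (real n * \<alpha>) (real n * \<beta>) f\<^sub>1 f\<^sub>2"
    using posn
  proof eventually_elim
    case (elim n)
    have "real n * \<alpha> + real n * \<beta> > 0" using elim pos by (simp flip: distrib_left)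
    then show ?case using nonneg by (simp add: apply_P_op)
  qed
  have scale: "uniform_limit UNIV (\<lambda>n x. r * F n x) (\<lambda>x. r * G x) sequentially"
    if "uniform_limit UNIV F G sequentially" for r :: real and F :: "nat \<Rightarrow> real \<Rightarrow> real" and G
    using that by (rule bounded_linear.uniform_limit[OF bounded_linear_mult_right])
  \<comment> \<open>Both coordinates have this shape; \<open>c\<close> and \<open>d\<close> multiply
    differences and so do not enter \<open>L\<close>.\<close>
  have lim: "X \<longlonglongrightarrow> L"
    if X: "\<forall>\<^sub>F n in sequentially. \<forall>x. apply_cinf (X n) x = apply_cinf e x
      + a * (exp_average 1 k (real n * \<gamma>) x + exp_average (-1) k (real n * \<gamma>) x)
      + b * (exp_average 1 m (real n * \<gamma>) x + exp_average (-1) m (real n * \<gamma>) x)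
      + c * (exp_average 1 k (real n * \<gamma>) x - exp_average (-1) k (real n * \<gamma>) x)
      + d * (exp_average 1 m (real n * \<gamma>) x - exp_average (-1) m (real n * \<gamma>) x)"
      and L: "L = e + (2 * a) *\<^sub>R k + (2 * b) *\<^sub>R m" for X L e and a b c d :: real
  proof -
    have "uniform_limit UNIV (\<lambda>n x. apply_cinf e x
      + a * (exp_average 1 k (real n * \<gamma>) x + exp_average (-1) k (real n * \<gamma>) x)
      + b * (exp_average 1 m (real n * \<gamma>) x + exp_average (-1) m (real n * \<gamma>) x)
      + c * (exp_average 1 k (real n * \<gamma>) x - exp_average (-1) k (real n * \<gamma>) x)
      + d * (exp_average 1 m (real n * \<gamma>) x - exp_average (-1) m (real n * \<gamma>) x))
      (\<lambda>x. e x + a * (k x + k x) + b * (m x + m x) + c * (k x - k x) + d * (m x - m x)) sequentially"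
      by (intro uniform_limit_add uniform_limit_minus uniform_limit_const scale av1 av2)
    also have "(\<lambda>x. e x + a * (k x + k x) + b * (m x + m x) + c * (k x - k x) + d * (m x - m x))
        = apply_cinf L"
      by (auto simp: L)
    finally show ?thesis
      unfolding cinf_tendsto_iff_uniform_limit
      by (rule uniform_limit_cong[THEN iffD1, rotated -1]) (use X in \<open>auto elim!: eventually_mono\<close>)
  qed
  have "(\<lambda>n. fst (P_op (real n * \<alpha>) (real n * \<beta>) (f\<^sub>1, f\<^sub>2))) \<longlonglongrightarrow> fst (P_skew \<alpha> \<beta> (f\<^sub>1, f\<^sub>2))"
  proof (rule lim[where e = "even_part f\<^sub>1" and a = "\<alpha> / \<gamma>\<^sup>2" and b = "- (1/4)" and c = "- (1 / (2 * \<gamma>))"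
        and d = "\<alpha> / (2 * \<gamma>)"])
    show "\<forall>\<^sub>F n in sequentially. \<forall>x. apply_cinf (fst (P_op (real n * \<alpha>) (real n * \<beta>) (f\<^sub>1, f\<^sub>2))) x
      = even_part f\<^sub>1 x + \<alpha> / \<gamma>\<^sup>2 * (exp_average 1 k (real n * \<gamma>) x + exp_average (-1) k (real n * \<gamma>) x)
      + - (1/4) * (exp_average 1 m (real n * \<gamma>) x + exp_average (-1) m (real n * \<gamma>) x)
      + - (1 / (2 * \<gamma>)) * (exp_average 1 k (real n * \<gamma>) x - exp_average (-1) k (real n * \<gamma>) x)
      + \<alpha> / (2 * \<gamma>) * (exp_average 1 m (real n * \<gamma>) x - exp_average (-1) m (real n * \<gamma>) x)"
      using posn eq
    proof eventually_elim
      case (elim n)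
      then show ?case
        using P_exp_average_scaled(1)[OF _ pos, of "real n"] unfolding k_def m_def \<gamma>_def by simp
    qed
  qed (simp add: P_skew_def k_def m_def \<gamma>_def)
  moreover have "(\<lambda>n. snd (P_op (real n * \<alpha>) (real n * \<beta>) (f\<^sub>1, f\<^sub>2))) \<longlonglongrightarrow> snd (P_skew \<alpha> \<beta> (f\<^sub>1, f\<^sub>2))"
  proof (rule lim[where e = "even_part f\<^sub>2" and a = "\<beta> / \<gamma>\<^sup>2" and b = "1/4" and c = "1 / (2 * \<gamma>)"
        and d = "\<beta> / (2 * \<gamma>)"])
    show "\<forall>\<^sub>F n in sequentially. \<forall>x. apply_cinf (snd (P_op (real n * \<alpha>) (real n * \<beta>) (f\<^sub>1, f\<^sub>2))) x
      = even_part f\<^sub>2 x + \<beta> / \<gamma>\<^sup>2 * (exp_average 1 k (real n * \<gamma>) x + exp_average (-1) k (real n * \<gamma>) x)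
      + 1/4 * (exp_average 1 m (real n * \<gamma>) x + exp_average (-1) m (real n * \<gamma>) x)
      + 1 / (2 * \<gamma>) * (exp_average 1 k (real n * \<gamma>) x - exp_average (-1) k (real n * \<gamma>) x)
      + \<beta> / (2 * \<gamma>) * (exp_average 1 m (real n * \<gamma>) x - exp_average (-1) m (real n * \<gamma>) x)"
      using posn eq
    proof eventually_elim
      case (elim n)
      then show ?case
        using P_exp_average_scaled(2)[OF _ pos, of "real n"] unfolding k_def m_def \<gamma>_def by simp
    qed
  qed (simp add: P_skew_def k_def m_def \<gamma>_def)
  ultimately show ?thesis
    using tendsto_Pair by fastforce
qed

section \<open>The limit is a projection\<close>

lemma bounded_linear_reflect: "bounded_linear reflect"
proof (rule bounded_linear_intro[where K = 1])
  show "norm (reflect f) \<le> norm f * 1" for f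
    by (rule cinf_norm_le) (use cinf_abs_le_norm[of f] in simp)
qed (auto intro!: cinf_eqI)

lemma bounded_linear_P_skew: "bounded_linear (P_skew \<alpha> \<beta>)"
proof -
  note r = bounded_linear_compose[OF bounded_linear_reflect]
  have "bounded_linear (\<lambda>p. P_skew \<alpha> \<beta> (fst p, snd p))"
    unfolding P_skew_def case_prod_conv k1_def k2_def even_part_def odd_part_def
    by (intro bounded_linear_Pair bounded_linear_add bounded_linear_sub r
        bounded_linear_const_scaleR bounded_linear_fst bounded_linear_snd)
  then show ?thesis by simp
qed

text \<open>Under \<open>x \<mapsto> - x\<close> the first equation is unchanged and the second
  changes sign on both sides, so a half-line suffices. This suits the piecewise definition of
  \<open>E_skew\<close>.\<close>

lemma C_skew_iff:
  "(g\<^sub>1, g\<^sub>2) \<in> C_skew \<alpha> \<beta> \<longleftrightarrow> (\<forall>x\<ge>0. g\<^sub>1 x + g\<^sub>1 (- x) = g\<^sub>2 x + g\<^sub>2 (- x) \<and>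
    \<beta> * (g\<^sub>1 x - g\<^sub>1 (- x)) = \<alpha> * (g\<^sub>2 x - g\<^sub>2 (- x)))" (is "_ \<longleftrightarrow> (\<forall>x\<ge>0. ?P x)")
proof -
  have "even_part g\<^sub>1 = even_part g\<^sub>2 \<longleftrightarrow> g\<^sub>1 + reflect g\<^sub>1 = g\<^sub>2 + reflect g\<^sub>2"
    by (simp only: even_part_def scaleR_cancel_left) simp
  moreover have "\<beta> *\<^sub>R odd_part g\<^sub>1 = \<alpha> *\<^sub>R odd_part g\<^sub>2 \<longleftrightarrow>
      \<beta> *\<^sub>R (g\<^sub>1 - reflect g\<^sub>1) = \<alpha> *\<^sub>R (g\<^sub>2 - reflect g\<^sub>2)"
    by (simp only: odd_part_def scaleR_left_commute[of _ "1/2"] scaleR_cancel_left) simp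
  ultimately have "(g\<^sub>1, g\<^sub>2) \<in> C_skew \<alpha> \<beta> \<longleftrightarrow> (\<forall>x. ?P x)"
    by (simp only: C_skew_def mem_Collect_eq case_prod_conv apply_cinf_inject[symmetric] fun_eq_iff
        cinf_rep_eq reflect_rep_eq all_conj_distrib)
  also have "?P (- x) = ?P x" for x by (auto simp: algebra_simps)
  then have "(\<forall>x. ?P x) \<longleftrightarrow> (\<forall>x\<ge>0. ?P x)"
    by (metis linorder_le_cases neg_0_le_iff_le)
  finally show ?thesis .
qed

text \<open>Pointwise this is orthogonal projection in the plane: the pair of even parts goes to its
  mean, along \<open>(1, 1)\<close>, and the pair of odd parts is projected on the direction
  \<open>(\<alpha>, \<beta>)\<close>, because
  \<open>2 / \<gamma>^2 = 1 / (\<alpha>^2 + \<beta>^2)\<close>. It suffices that the map has values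
  in \<open>C_skew\<close> and fixes its elements.\<close>

lemma projection_P_skew:
  assumes "\<alpha> + \<beta> > 0"
  shows "projection_on (P_skew \<alpha> \<beta>) (C_skew \<alpha> \<beta>)"
proof -
  define r where "r = \<alpha>\<^sup>2 + \<beta>\<^sup>2"
  have g: "(gam \<alpha> \<beta>)\<^sup>2 = 2 * r" by (simp add: gam_def r_def)
  have r: "r \<noteq> 0" using assms by (auto simp: r_def sum_power2_eq_zero_iff)
  have into: "P_skew \<alpha> \<beta> p \<in> C_skew \<alpha> \<beta>" for p
  proof -
    obtain f\<^sub>1 f\<^sub>2 where p: "p = (f\<^sub>1, f\<^sub>2)" by (cases p)
    have even: "even_part f (- x) = even_part f x" for f x by (simp add: even_part_def)
    show ?thesis
      by (simp add: p P_skew_def C_skew_iff k1_odd k2_even even) (simp add: k2_def)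
  qed
  have fixed: "P_skew \<alpha> \<beta> p = p" if "p \<in> C_skew \<alpha> \<beta>" for p
  proof -
    obtain g1 g2 where p: "p = (g1, g2)" by (cases p)
    have e: "even_part g1 = even_part g2" and o: "\<beta> *\<^sub>R odd_part g1 = \<alpha> *\<^sub>R odd_part g2"
      using that by (auto simp: p C_skew_def)
    have sum: "even_part g + odd_part g = g" for g
      by (intro cinf_eqI) (simp add: even_part_def odd_part_def flip: add_divide_distrib)
    \<comment> \<open>Multiplying \<open>o\<close> by \<beta> turns the mixed term of \<alpha> times
      \<open>k1\<close> into \<beta> squared times the odd part of \<open>g1\<close>;
      \<open>b\<close> is symmetric.\<close>
    have a: "\<alpha> *\<^sub>R k1 \<alpha> \<beta> g1 g2 = r *\<^sub>R odd_part g1"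
      unfolding r_def k1_def scaleR_add_right scaleR_left_distrib power2_eq_square
      using arg_cong[OF o, of "scaleR \<beta>"] by (simp add: mult.commute)
    have b: "\<beta> *\<^sub>R k1 \<alpha> \<beta> g1 g2 = r *\<^sub>R odd_part g2"
      unfolding r_def k1_def scaleR_add_right scaleR_left_distrib power2_eq_square
      using arg_cong[OF o, of "scaleR \<alpha>"] by (simp add: mult.commute)
    have "(2 * \<alpha> / (gam \<alpha> \<beta>)\<^sup>2) *\<^sub>R k1 \<alpha> \<beta> g1 g2 = odd_part g1"
      using arg_cong[OF a, of "scaleR (1 / r)"] r by (simp add: g)
    moreover have "(2 * \<beta> / (gam \<alpha> \<beta>)\<^sup>2) *\<^sub>R k1 \<alpha> \<beta> g1 g2 = odd_part g2"
      using arg_cong[OF b, of "scaleR (1 / r)"] r by (simp add: g)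
    ultimately show ?thesis by (simp add: p P_skew_def k2_def e sum sum[of g1, unfolded e])
  qed
  have "range (P_skew \<alpha> \<beta>) = C_skew \<alpha> \<beta>"
    using into fixed by (metis image_subset_iff subset_antisym rangeI subsetI)
  then show ?thesis
    using bounded_linear_P_skew into fixed by (auto simp: projection_on_def)
qed

section \<open>The range of the extension operator\<close>

lemma cinf_fun_glue:
  assumes gh: "cinf_fun g" "cinf_fun h" "g 0 = h 0"
  shows "cinf_fun (\<lambda>x. if x \<le> 0 then g x else h x)"
proof -
  have "continuous_on ({..0} \<union> {0..}) (\<lambda>x. if x \<le> 0 then g x else h x)"
    using gh by (intro continuous_on_If) (auto simp: cinf_fun_def intro: continuous_on_subset)
  moreover have "{..0::real} \<union> {0..} = UNIV" by auto
  moreover obtain l where "(h \<longlongrightarrow> l) at_top" using gh by (auto simp: cinf_fun_def)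
  then have "((\<lambda>x. if x \<le> 0 then g x else h x) \<longlongrightarrow> l) at_top"
    by (rule tendsto_eq_eventually, intro eventually_mono[OF eventually_gt_at_top[of 0]]) auto
  moreover obtain m where "(g \<longlongrightarrow> m) at_bot" using gh by (auto simp: cinf_fun_def)
  then have "((\<lambda>x. if x \<le> 0 then g x else h x) \<longlongrightarrow> m) at_bot"
    by (rule tendsto_eq_eventually, intro eventually_mono[OF eventually_le_at_bot[of 0]]) auto
  ultimately show ?thesis unfolding cinf_fun_def by auto
qed

text \<open>For \<open>x > 0\<close> the two conditions form a linear system for \<open>g1 x\<close>
  and \<open>g2 (- x)\<close> with determinant \<open>\<alpha> + \<beta>\<close>. Hence
  \<open>g1\<close> on the left and \<open>g2\<close> on the right half-line determine the pair, and
  solving the system gives the formulas of \<open>E_skew\<close>.\<close>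

lemma C_skew_eq_range_E_skew:
  assumes pos: "\<alpha> + \<beta> > 0"
  shows "C_skew \<alpha> \<beta> = range (E_skew \<alpha> \<beta>)"
proof (intro subset_antisym subsetI)
  fix p assume "p \<in> range (E_skew \<alpha> \<beta>)"
  then obtain f where p: "p = E_skew \<alpha> \<beta> f" by blast
  have ne: "\<alpha> + \<beta> \<noteq> 0" using pos by simp
  have "(fst (E_skew \<alpha> \<beta> f), snd (E_skew \<alpha> \<beta> f)) \<in> C_skew \<alpha> \<beta>"
    unfolding C_skew_iff apply_E_skew[OF ne] E_left_def E_right_def
    using pos by (auto simp: divide_simps) (auto simp: algebra_simps)
  then show "p \<in> C_skew \<alpha> \<beta>" by (simp add: p)
next
  fix p assume "p \<in> C_skew \<alpha> \<beta>"
  moreover obtain g1 g2 where p: "p = (g1, g2)" by (cases p)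
  ultimately have *: "g1 x + g1 (- x) = g2 x + g2 (- x)"
     "\<beta> * (g1 x - g1 (- x)) = \<alpha> * (g2 x - g2 (- x))" if "x \<ge> 0" for x
    using that by (simp_all add: C_skew_iff)
  \<comment> \<open>The preimage is forced: \<open>E_left\<close> keeps \<open>f\<close> on the left
    and \<open>E_right\<close> keeps it on the right. The first condition at 0 makes the pieces
    fit.\<close>
  define f where "f = Abs_cinf (\<lambda>x. if x \<le> 0 then g1 x else g2 x)"
  have f: "apply_cinf f = (\<lambda>x. if x \<le> 0 then g1 x else g2 x)"
    unfolding f_def using *[of 0] by (intro apply_Abs_cinf cinf_fun_glue cinf_fun_apply) simp
  have ne: "\<alpha> + \<beta> \<noteq> 0" using pos by simp
  have "fst (E_skew \<alpha> \<beta> f) = g1"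
  proof (rule cinf_eqI)
    fix x
    \<comment> \<open>Adding \<alpha> times the first condition to the second eliminates
      \<open>g2 (- x)\<close>.\<close>
    have "(\<beta> - \<alpha>) * g1 (- x) + 2 * \<alpha> * g2 x = (\<alpha> + \<beta>) * g1 x" if "x > 0"
      using *[of x] that by (simp, algebra)
    then show "fst (E_skew \<alpha> \<beta> f) x = g1 x"
      using ne by (auto simp: apply_E_skew[OF ne] E_left_def f add_divide_distrib[symmetric] divide_eq_eq mult.commute)
  qed
  moreover have "snd (E_skew \<alpha> \<beta> f) = g2"
  proof (rule cinf_eqI)
    fix x
    \<comment> \<open>At \<open>- x\<close>, subtracting the second condition from \<beta> times the
      first eliminates \<open>g1 (- x)\<close>.\<close>
    have "2 * \<beta> * g1 x + (\<alpha> - \<beta>) * g2 (- x) = (\<alpha> + \<beta>) * g2 x" if "x < 0"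
      using *[of "- x"] that by (simp, algebra)
    then show "snd (E_skew \<alpha> \<beta> f) x = g2 x"
      \<comment> \<open>At 0 the glued \<open>f\<close> takes the value of \<open>g1\<close>, so
        \<open>g1 0 = g2 0\<close> is needed.\<close>
      using ne *[of 0] by (auto simp: apply_E_skew[OF ne] E_right_def f add_divide_distrib[symmetric] divide_eq_eq mult.commute)
  qed
  ultimately show "p \<in> range (E_skew \<alpha> \<beta>)" by (metis p prod.collapse rangeI)
qed

theorem theorem6p1:
  fixes \<alpha> \<beta> :: real
  assumes "\<alpha> \<ge> 0" "\<beta> \<ge> 0" "\<alpha> + \<beta> > 0"
  shows "(\<forall>f\<^sub>1 f\<^sub>2 :: cinf. (\<lambda>n. P_op (real n * \<alpha>) (real n * \<beta>) (f\<^sub>1, f\<^sub>2)) \<longlonglongrightarrow> P_skew \<alpha> \<beta> (f\<^sub>1, f\<^sub>2))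
    \<and> projection_on (P_skew \<alpha> \<beta>) (C_skew \<alpha> \<beta>)
    \<and> C_skew \<alpha> \<beta> = range (E_skew \<alpha> \<beta>)"
  using P_op_tendsto_P_skew[OF assms] projection_P_skew[OF assms(3)]
    C_skew_eq_range_E_skew[OF assms(3)] by blast

end
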